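(* There exist constants $c>0$ and $\lambda_0>0$ such that for every $\lambda>\lambda_0$ there is a constant $C_\lambda>0$ such that, for every $x\in\mathbb{T}$ and all energies $E_1\neq E_2$ in the spectrum $\sigma(H(x))$, $$|L(E_1)-L(E_2)|<C_\lambda\,|E_1-E_2|^{\frac{c}{(\log\lambda)^3}} .$$
   Context: $\mathbb{T}=\mathbb{R}/\mathbb{Z}$, $\mathbb{N}=\{0,1,2,\dots\}$, and $T:\mathbb{T}\to\mathbb{T}$, $Tx=2x \bmod 1$, is the doubling map. The function $f:\mathbb{T}\to\mathbb{R}$ is fixed and satisfies: $f$ is monotonic (on $[0,1)$) and $C^1$ on $(0,1)$; on the torus, $x=0$ is a jump discontinuity point of $f$; $f(0)=\lim_{x\to0^+}f(x)$; the right derivative $f'_+(0)$ exists and is finite; $\inf_{x\in(0,1)}|f'(x)|>0$; and $\|f\|_{C^1(0,1)}<\infty$. For $\lambda>0$ and $x\in\mathbb{T}$, $H(x)$ is the operator on $\ell^2(\mathbb{N})$ given by $(H(x)u)_n=u_{n+1}+u_{n-1}+\lambda f(T^nx)u_n$ for $n\ge0$, with the Dirichlet condition $u_{-1}=0$. For $E\in\mathbb{R}$ put $A(x,E)=\begin{pmatrix}E-\lambda f(x)&-1\\1&0\end{pmatrix}$ and $A_n(x,E)=A(T^nx,E)A(T^{n-1}x,E)\cdots A(Tx,E)$ for $n\ge1$. The Lyapunov exponent is $L(E)=\lim_{n\to\infty}\frac1n\int_{\mathbb{T}}\log\|A_n(x,E)\|\,dx$, with $\|\cdot\|$ the operator norm.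 The constants $c,\lambda_0,C_\lambda$ may depend on $f$. *)

theory Defs
  imports "HOL-Analysis.Analysis"
begin

text \<open>
  The circle $\mathbb{R}/\mathbb{Z}$ is represented by its fundamental domain \<open>{0..<1}\<close>. A function on
  the circle is a function on the reals whose values outside \<open>{0..<1}\<close> are never used; the one-sided
  limit at the point 0 of the circle from the left is the limit \<open>at_left 1\<close>.
\<close>

definition doubling :: "real \<Rightarrow> real" where
  "doubling x = frac (2 * x)"

definition ell2 :: "(nat \<Rightarrow> complex) set" where
  "ell2 = {u. summable (\<lambda>n. (cmod (u n))\<^sup>2)}"

definition ell2_norm :: "(nat \<Rightarrow> complex) \<Rightarrow> real" where
  "ell2_norm u = sqrt (\<Sum>n. (cmod (u n))\<^sup>2)"

definition ell2_bounded_linear :: "((nat \<Rightarrow> complex) \<Rightarrow> (nat \<Rightarrow> complex)) \<Rightarrow> bool" where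
  "ell2_bounded_linear A \<longleftrightarrow>
     (\<forall>u\<in>ell2. A u \<in> ell2) \<and>
     (\<forall>u\<in>ell2. \<forall>v\<in>ell2. A (\<lambda>n. u n + v n) = (\<lambda>n. A u n + A v n)) \<and>
     (\<forall>a. \<forall>u\<in>ell2. A (\<lambda>n. a * u n) = (\<lambda>n. a * A u n)) \<and>
     (\<exists>K. \<forall>u\<in>ell2. ell2_norm (A u) \<le> K * ell2_norm u)"

definition ell2_resolvent_set :: "((nat \<Rightarrow> complex) \<Rightarrow> (nat \<Rightarrow> complex)) \<Rightarrow> complex set" where
  "ell2_resolvent_set A = {z. \<exists>R. ell2_bounded_linear R \<and>
     (\<forall>u\<in>ell2. R (\<lambda>n. A u n - z * u n) = u) \<and>
     (\<forall>u\<in>ell2. (\<lambda>n. A (R u) n - z * R u n) = u)}"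

definition ell2_spectrum :: "((nat \<Rightarrow> complex) \<Rightarrow> (nat \<Rightarrow> complex)) \<Rightarrow> complex set" where
  "ell2_spectrum A = - ell2_resolvent_set A"

definition schroedinger ::
  "(real \<Rightarrow> real) \<Rightarrow> real \<Rightarrow> real \<Rightarrow> (nat \<Rightarrow> complex) \<Rightarrow> (nat \<Rightarrow> complex)" where
  "schroedinger f lam x u =
     (\<lambda>n. u (n + 1) + (if n = 0 then 0 else u (n - 1))
          + complex_of_real (lam * f ((doubling ^^ n) x)) * u n)"

definition transfer_matrix :: "(real \<Rightarrow> real) \<Rightarrow> real \<Rightarrow> real \<Rightarrow> real \<Rightarrow> real^2^2" where
  "transfer_matrix f lam E x = vector [vector [E - lam * f x, -1], vector [1, 0]]"

text \<open>The factors run from \<open>doubling x\<close> (rightmost) to \<open>(doubling ^^ n) x\<close> (leftmost).\<close>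

primrec cocycle :: "(real \<Rightarrow> real) \<Rightarrow> real \<Rightarrow> real \<Rightarrow> nat \<Rightarrow> real \<Rightarrow> real^2^2" where
  "cocycle f lam E 0 x = mat 1"
| "cocycle f lam E (Suc n) x =
     transfer_matrix f lam E ((doubling ^^ Suc n) x) ** cocycle f lam E n x"

definition lyapunov :: "(real \<Rightarrow> real) \<Rightarrow> real \<Rightarrow> real \<Rightarrow> real" where
  "lyapunov f lam E =
     lim (\<lambda>n. (1 / real n) *
       (LINT x:{0..<1}|lborel. ln (onorm (\<lambda>v. cocycle f lam E n x *v v))))"

end

theory Submission imports Defs begin

text \<open>
Read from left to right, the cocycle is a random product. If $x$ is uniformly distributed and $T^n x=y$
is known, then $T^{n-1}x, T^{n-2}x, \dots, x$ is a Markov chain started at $y$: each step replaces $z$ by one of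
the two preimages $z/2$, $(z+1)/2$ with probability $1/2$. A row vector $s$ multiplied by $A_n(x)$ meets
the factor at $T^n x$ first, so $s A_n(x)$ is a random walk driven by this chain, and its conditional
expectations given $T^n x=y$ are the finite averages \<open>fibre_mean\<close>. Hoelder continuity then follows by the
method of Le Page for random matrix products, from an estimate that is uniform in the initial point $y$ and the
initial vector $s$.

\<^bold>\<open>Growth.\<close> Call $v$ flat if $|v_1|<\kappa|v_2|$, where $\kappa$ is a small multiple of $\lambda$. One factor
multiplies the norm by at least $\kappa/2$ unless the vector is flat before or after the step. Since $f$ is
steep, the two preimages of a point give entries $E-\lambda f$ far apart, so after the next random
factor a flat vector is still flat with probability at most $1/2$, and a non-flat vector becomes flat only
at a point where $|E-\lambda f|<2\kappa$; among the 32 points of $T^{-5}y$ there is at most one of these. After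
a few steps the probability of flatness is therefore at most $3/32$, which makes the expected logarithmic growth
of each later step at least $\frac12\log\lambda$; this outweighs the possible loss in the other steps
(\<open>flat_after_rare\<close>, \<open>mean_log_growth\<close>).

\<^bold>\<open>Contraction.\<close> After 37 steps the expected logarithmic growth is at least $\log\lambda$, while the growth itself
is at most of order $\log\lambda$; expanding the exponential, $\mathbb{E}|sA_{37}|^{-t}\le\rho|s|^{-t}$ with
$\rho<1$ for $t$ up to a multiple of $1/\log\lambda$ (\<open>moment_contraction\<close>). All matrices have determinant
1, so $d(u,v)=|u\wedge v|/(|u||v|)$ is multiplied by $|u||v|/(|uA_n||vA_n|)$, and the expectations of
$d(uA_n,vA_n)^{t/2}$ are summable in $n$.

\<^bold>\<open>Regularity.\<close> The one-step logarithmic growth is a Lipschitz function of the direction, hence the expected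
logarithmic growth over any number of steps depends on the initial vector only up to $C d(u,v)^{t/2}$
(\<open>log_ratio_mean_bounded\<close>). This makes the sequence $\int\log|s A_n|$ additive up to a bounded error, which gives
the limit $L(E)$. Changing $E$ to $E'$ in one factor turns the vector by at most $|E-E'|$; replacing the
factors one at a time changes $\int\log|sA_n|$ by at most $n(|E-E'|+C|E-E'|^{t/2})$ (\<open>lyapunov_hoelder\<close>).

All constants are uniform for $|E|\le 2+\lambda\|f\|_\infty$, and the spectrum is contained in that interval
(\<open>schroedinger_spectrum_bounded\<close>). The exponent $t/2=c/(\log\lambda)^3$ is well within the admissible range.
\<close>

section \<open>Averages over the fibres of the doubling map\<close>

lemma doubling_in_unit: "doubling x \<in> {0..<1}"
  by (simp add: doubling_def frac_lt_1)

lemma funpow_doubling_in_unit: "x \<in> {0..<1} \<Longrightarrow> (doubling ^^ n) x \<in> {0..<1}"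
  by (cases n) (simp_all add: doubling_in_unit del: atLeastLessThan_iff)

lemma doubling_branches:
  assumes "y \<in> {0..<1}"
  shows "doubling (y / 2) = y" "doubling ((y + 1) / 2) = y"
    "y / 2 \<in> {0..<1}" "(y + 1) / 2 \<in> {0..<1}"
proof -
  have "2 * ((y + 1) / 2) = y + 1" by simp
  moreover have "frac (y + 1) = frac y" by (simp add: frac_def)
  ultimately have "frac (2 * ((y + 1) / 2)) = frac y" by metis
  then show "doubling ((y + 1) / 2) = y" using assms by (simp add: doubling_def frac_eq)
qed (use assms in \<open>auto simp: doubling_def frac_eq\<close>)

text \<open>
The conditional expectation of \<open>h x\<close> given \<open>(doubling ^^ n) x = y\<close>, for uniformly distributed \<open>x\<close>; equivalently
the \<open>n\<close>-th power of the transfer operator of the doubling map.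
\<close>

primrec fibre_mean :: "nat \<Rightarrow> (real \<Rightarrow> real) \<Rightarrow> real \<Rightarrow> real" where
  "fibre_mean 0 h y = h y"
| "fibre_mean (Suc n) h y = (fibre_mean n h (y / 2) + fibre_mean n h ((y + 1) / 2)) / 2"

text \<open>
Only the points of the fibre over \<open>y\<close> matter, and they may be used in the comparison; this is how the
information \<open>(doubling ^^ n) x = y\<close> enters every estimate below.
\<close>

lemma fibre_mean_mono:
  assumes "y \<in> {0..<1}"
    and "\<And>x. x \<in> {0..<1} \<Longrightarrow> (doubling ^^ n) x = y \<Longrightarrow> h x \<le> g x"
  shows "fibre_mean n h y \<le> fibre_mean n g y"
  using assms
proof (induction n arbitrary: y)
  case (Suc n)
  have "fibre_mean n h z \<le> fibre_mean n g z" if "z \<in> {0..<1}" "doubling z = y" for z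
    using that by (intro Suc.IH Suc.prems) auto
  from this[of "y/2"] this[of "(y+1)/2"] doubling_branches[OF Suc.prems(1)] show ?case by simp
qed simp

lemma fibre_mean_cong:
  assumes "y \<in> {0..<1}"
    and "\<And>x. x \<in> {0..<1} \<Longrightarrow> (doubling ^^ n) x = y \<Longrightarrow> h x = g x"
  shows "fibre_mean n h y = fibre_mean n g y"
  using assms by (intro antisym fibre_mean_mono) auto

lemma fibre_mean_add: "fibre_mean n (\<lambda>x. h x + g x) y = fibre_mean n h y + fibre_mean n g y"
  by (induction n arbitrary: y) (auto simp: field_simps)

lemma fibre_mean_diff: "fibre_mean n (\<lambda>x. h x - g x) y = fibre_mean n h y - fibre_mean n g y"
  using fibre_mean_add[of n "\<lambda>x. h x - g x" g y] by simp

lemma fibre_mean_cmult: "fibre_mean n (\<lambda>x. c * h x) y = c * fibre_mean n h y"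
  by (induction n arbitrary: y) (auto simp: field_simps)

lemma fibre_mean_const [simp]: "fibre_mean n (\<lambda>x. c) y = c"
  by (induction n arbitrary: y) auto

lemma fibre_mean_abs: "\<bar>fibre_mean n h y\<bar> \<le> fibre_mean n (\<lambda>x. \<bar>h x\<bar>) y"
proof (induction n arbitrary: y)
  case (Suc n)
  show ?case using Suc[of "y/2"] Suc[of "(y+1)/2"] by simp
qed simp

lemma fibre_mean_compose: "fibre_mean (m + n) h y = fibre_mean n (fibre_mean m h) y"
  by (induction n arbitrary: y) auto

text \<open>
The Markov property: given the endpoint \<open>y\<close>, choose the intermediate point \<open>z\<close> of the backward orbit first and then
the points above \<open>z\<close>.
\<close>

lemma fibre_mean_markov:
  assumes "y \<in> {0..<1}"
  shows "fibre_mean (m + n) (\<lambda>x. G ((doubling ^^ m) x) x) y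
       = fibre_mean n (\<lambda>z. fibre_mean m (G z) z) y"
  unfolding fibre_mean_compose
  by (rule fibre_mean_cong[OF assms], rule fibre_mean_cong) auto

lemma fibre_mean_doubling:
  assumes "y \<in> {0..<1}"
  shows "fibre_mean (Suc n) (\<lambda>x. h (doubling x)) y = fibre_mean n h y"
  using fibre_mean_markov[OF assms, of 1 n "\<lambda>z x. h z"] by simp

lemma fibre_mean_grid: "fibre_mean n h y = (\<Sum>i<2^n. h ((y + real i) / 2 ^ n)) / 2 ^ n"
proof (induction n arbitrary: y)
  case (Suc n)
  have e: "(y / 2 + real i) / 2 ^ n = (y + real (2*i)) / 2 ^ Suc n"
          "((y + 1) / 2 + real i) / 2 ^ n = (y + real (Suc (2*i))) / 2 ^ Suc n" for i
    by (auto simp: field_simps)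
  have "(\<Sum>i<2 ^ n. g (2*i)) + (\<Sum>i<2 ^ n. g (Suc (2*i))) = (\<Sum>i<2 ^ Suc n. g i)"
    for g :: "nat \<Rightarrow> real"
  proof -
    have "(\<Sum>i<2 * k. g i) = (\<Sum>i<k. g (2*i)) + (\<Sum>i<k. g (Suc (2*i)))" for k
      by (induction k) auto
    from this[of "2^n"] show ?thesis by simp
  qed
  from this[of "\<lambda>i. h ((y + real i) / 2 ^ Suc n)"]
  show ?case unfolding fibre_mean.simps Suc e by (simp add: field_simps)
qed simp

definition circle_mean :: "(real \<Rightarrow> real) \<Rightarrow> real" where
  "circle_mean h = (LINT x:{0..<1}|lborel. h x)"

text \<open>
A class of functions closed under the operations below on which \<open>circle_mean\<close> is a genuine integral.
\<close>

definition bounded_borel :: "(real \<Rightarrow> real) \<Rightarrow> bool" where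
  "bounded_borel h \<longleftrightarrow> h \<in> borel_measurable borel \<and> (\<exists>B. \<forall>x\<in>{0..<1}. \<bar>h x\<bar> \<le> B)"

lemma bounded_borelI:
  assumes "h \<in> borel_measurable borel" "\<And>x. x \<in> {0..<1} \<Longrightarrow> \<bar>h x\<bar> \<le> B"
  shows "bounded_borel h"
  using assms unfolding bounded_borel_def by blast

lemma bounded_borelE:
  assumes "bounded_borel h"
  obtains B where "h \<in> borel_measurable borel" "\<And>x. x \<in> {0..<1} \<Longrightarrow> \<bar>h x\<bar> \<le> B"
  using assms unfolding bounded_borel_def by blast

lemma bounded_borel_add: assumes "bounded_borel h" "bounded_borel g" shows "bounded_borel (\<lambda>x. h x + g x)"
proof -
  obtain B where h: "h \<in> borel_measurable borel" "\<And>x. x \<in> {0..<1} \<Longrightarrow> \<bar>h x\<bar> \<le> B"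
    using bounded_borelE[OF assms(1)] by blast
  obtain B' where g: "g \<in> borel_measurable borel" "\<And>x. x \<in> {0..<1} \<Longrightarrow> \<bar>g x\<bar> \<le> B'"
    using bounded_borelE[OF assms(2)] by blast
  show ?thesis
  proof (rule bounded_borelI)
    fix x :: real assume "x \<in> {0..<1}"
    from h(2)[OF this] g(2)[OF this] show "\<bar>h x + g x\<bar> \<le> B + B'" by linarith
  qed (intro borel_measurable_add h g)
qed

lemma bounded_borel_integrable: assumes "bounded_borel h" shows "set_integrable lborel {0..<1} h"
proof -
  obtain B where [measurable]: "h \<in> borel_measurable borel" and B: "\<And>x. x \<in> {0..<1} \<Longrightarrow> \<bar>h x\<bar> \<le> B"
    using bounded_borelE[OF assms] by blast
  have c: "integrable lborel (\<lambda>x. indicator {0..<1::real} x *\<^sub>R B)" by simp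
  show ?thesis unfolding set_integrable_def
  proof (rule Bochner_Integration.integrable_bound[OF c])
    show "AE x in lborel. norm (indicat_real {0..<1} x *\<^sub>R h x) \<le> norm (indicat_real {0..<1} x *\<^sub>R B)"
      using B by (intro AE_I2) (force simp: indicator_def)
  qed measurable
qed

lemma bounded_borel_fibre_mean: assumes "bounded_borel h" shows "bounded_borel (fibre_mean n h)"
proof -
  obtain B where [measurable]: "h \<in> borel_measurable borel" and B: "\<And>x. x \<in> {0..<1} \<Longrightarrow> \<bar>h x\<bar> \<le> B"
    using bounded_borelE[OF assms] by blast
  have "fibre_mean n h = (\<lambda>y. (\<Sum>i<2^n. h ((y + real i) / 2 ^ n)) / 2 ^ n)"
    by (auto simp: fibre_mean_grid)
  hence "fibre_mean n h \<in> borel_measurable borel" by simp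
  moreover have "\<bar>fibre_mean n h y\<bar> \<le> B" if "y \<in> {0..<1}" for y
    using fibre_mean_abs[of n h y] fibre_mean_mono[OF that, of n "\<lambda>x. \<bar>h x\<bar>" "\<lambda>_. B"] B by auto
  ultimately show ?thesis unfolding bounded_borel_def by blast
qed

text \<open>
The doubling map preserves Lebesgue measure; both halves of the circle are rescaled to the whole of it.
\<close>

lemma circle_mean_preimages:
  assumes "bounded_borel h" shows "circle_mean (fibre_mean 1 h) = circle_mean h"
proof -
  have "circle_mean h = (\<integral>x. indicator {0..<1/2} x *\<^sub>R h x + indicator {1/2..<1} x *\<^sub>R h x \<partial>lborel)"
    unfolding circle_mean_def set_lebesgue_integral_def
    by (rule Bochner_Integration.integral_cong) (auto simp: indicator_def)
  also have "\<dots> = (\<integral>x. indicator {0..<1/2} x *\<^sub>R h x \<partial>lborel) + (\<integral>x. indicator {1/2..<1} x *\<^sub>R h x \<partial>lborel)"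
    by (rule Bochner_Integration.integral_add;
        fold set_integrable_def, rule set_integrable_subset[OF bounded_borel_integrable[OF assms]]) auto
  also have "(\<integral>x. indicator {0..<1/2} x *\<^sub>R h x \<partial>lborel) = 1/2 * (\<integral>x. indicator {0..<1} x *\<^sub>R h (x/2) \<partial>lborel)"
    by (subst lborel_integral_real_affine[where c="1/2" and t=0])
       (auto intro!: Bochner_Integration.integral_cong simp: indicator_def)
  also have "(\<integral>x. indicator {1/2..<1} x *\<^sub>R h x \<partial>lborel) = 1/2 * (\<integral>x. indicator {0..<1} x *\<^sub>R h ((x+1)/2) \<partial>lborel)"
    by (subst lborel_integral_real_affine[where c="1/2" and t="1/2"])
       (auto intro!: Bochner_Integration.integral_cong simp: indicator_def field_simps)
  finally have *: "circle_mean h = 1/2 * (\<integral>x. indicator {0..<1} x *\<^sub>R h (x/2) \<partial>lborel)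
      + 1/2 * (\<integral>x. indicator {0..<1} x *\<^sub>R h ((x+1)/2) \<partial>lborel)" .
  obtain B where [measurable]: "h \<in> borel_measurable borel" and B: "\<And>x. x \<in> {0..<1} \<Longrightarrow> \<bar>h x\<bar> \<le> B"
    using bounded_borelE[OF assms] by blast
  have o: "bounded_borel (\<lambda>x. h (x/2))" "bounded_borel (\<lambda>x. h ((x+1)/2))"
    unfolding bounded_borel_def by (auto intro!: exI[of _ B] B)
  show ?thesis unfolding *
    using bounded_borel_integrable[OF o(1)] bounded_borel_integrable[OF o(2)]
    by (simp add: circle_mean_def set_lebesgue_integral_def set_integrable_def ring_distribs add_divide_distrib)
qed

lemma circle_mean_fibre_mean: assumes "bounded_borel h" shows "circle_mean (fibre_mean n h) = circle_mean h"
proof (induction n)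
  case 0 show ?case by (simp add: circle_mean_def)
next
  case (Suc n)
  have "fibre_mean (Suc n) h = fibre_mean 1 (fibre_mean n h)" by (rule ext) simp
  then show ?case using circle_mean_preimages[OF bounded_borel_fibre_mean[OF assms]] Suc by metis
qed

lemma circle_mean_add: "bounded_borel h \<Longrightarrow> bounded_borel g \<Longrightarrow> circle_mean (\<lambda>x. h x + g x) = circle_mean h + circle_mean g"
  by (simp add: circle_mean_def bounded_borel_integrable)

lemma circle_mean_abs_diff_le:
  assumes "bounded_borel h" "bounded_borel g" "\<And>x. x \<in> {0..<1} \<Longrightarrow> \<bar>h x - g x\<bar> \<le> c"
  shows "\<bar>circle_mean h - circle_mean g\<bar> \<le> c"
proof -
  have i: "set_integrable lborel {0..<1} (\<lambda>x. h x - g x)"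
    using assms(1,2) by (simp add: bounded_borel_integrable)
  have c: "set_integrable lborel {0..<1::real} (\<lambda>x. c)" for c :: real
    unfolding set_integrable_def by simp
  have cc: "(LINT x:{0..<1::real}|lborel. c) = c" for c :: real
    unfolding set_lebesgue_integral_def by simp
  have "circle_mean h - circle_mean g = (LINT x:{0..<1}|lborel. h x - g x)"
    using assms by (simp add: circle_mean_def bounded_borel_integrable)
  moreover have "(LINT x:{0..<1}|lborel. h x - g x) \<le> c"
    using set_integral_mono[OF i c[of c]] assms(3) unfolding cc by force
  moreover have "-c \<le> (LINT x:{0..<1}|lborel. h x - g x)"
    using set_integral_mono[OF c[of "-c"] i] assms(3) unfolding cc by force
  ultimately show ?thesis by linarith
qed

section \<open>The cocycle acting on row vectors\<close>

lemma row_transfer: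
  "(v v* transfer_matrix f lam E x) $ 1 = (E - lam * f x) * v $ 1 + v $ 2"
  "(v v* transfer_matrix f lam E x) $ 2 = - v $ 1"
  by (simp_all add: vector_matrix_mult_def transfer_matrix_def sum_2)

lemma cocycle_add:
  "cocycle f lam E (m + n) x = cocycle f lam E n ((doubling ^^ m) x) ** cocycle f lam E m x"
proof (induction n)
  case (Suc n)
  have "(doubling ^^ Suc n) ((doubling ^^ m) x) = (doubling ^^ Suc (m + n)) x"
    using funpow_add[of "Suc n" m doubling] by (simp add: add.commute)
  then show ?case using Suc by (simp add: matrix_mul_assoc)
qed simp

text \<open>
A row vector meets the factors with the largest index first, so the part of the orbit that is known when conditioning on
\<open>(doubling ^^ (m + n)) x\<close> acts before the part that is still random.
\<close>

lemma row_cocycle_add: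
  "v v* cocycle f lam E (m + n) x
     = (v v* cocycle f lam E n ((doubling ^^ m) x)) v* cocycle f lam E m x"
  by (simp add: cocycle_add vector_matrix_mul_assoc)

lemma row_cocycle_Suc:
  "v v* cocycle f lam E (Suc n) x
     = (v v* cocycle f lam E n (doubling x)) v* transfer_matrix f lam E (doubling x)"
  using row_cocycle_add[of v f lam E 1 n x] by simp

lemma norm_real2_le: "norm (v :: real^2) \<le> \<bar>v $ 1\<bar> + \<bar>v $ 2\<bar>"
  using norm_le_l1_cart[of v] by (simp add: sum_2)

lemma norm_real2_sq: "(norm (v :: real^2))\<^sup>2 = (v $ 1)\<^sup>2 + (v $ 2)\<^sup>2"
  by (simp add: norm_eq_sqrt_inner inner_vec_def sum_2 power2_eq_square)

lemma norm_row_transfer: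
  assumes "\<bar>E - lam * f x\<bar> + 2 \<le> K"
  shows "norm (v v* transfer_matrix f lam E x) \<le> K * norm v"
    and "norm v \<le> K * norm (v v* transfer_matrix f lam E x)"
proof -
  let ?V = "E - lam * f x" and ?w = "v v* transfer_matrix f lam E x"
  have vb: "\<bar>u $ i\<bar> \<le> norm u" for u :: "real^2" and i by (rule component_le_norm_cart)
  have "norm ?w \<le> \<bar>?V * v $ 1 + v $ 2\<bar> + \<bar>v $ 1\<bar>"
    using norm_real2_le[of ?w] by (simp add: row_transfer)
  also have "\<dots> \<le> \<bar>?V\<bar> * \<bar>v $ 1\<bar> + \<bar>v $ 2\<bar> + \<bar>v $ 1\<bar>"
    using abs_triangle_ineq[of "?V * v $ 1" "v $ 2"] by (simp add: abs_mult)
  also have "\<dots> \<le> \<bar>?V\<bar> * norm v + norm v + norm v"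
    by (intro add_mono mult_left_mono vb) auto
  also have "\<dots> \<le> K * norm v"
    using mult_right_mono[OF assms norm_ge_zero[of v]] by (simp add: algebra_simps)
  finally show "norm ?w \<le> K * norm v" .
  have v: "v $ 1 = - ?w $ 2" "v $ 2 = ?w $ 1 + ?V * ?w $ 2" by (simp_all add: row_transfer)
  have "norm v \<le> \<bar>?w $ 2\<bar> + \<bar>?w $ 1 + ?V * ?w $ 2\<bar>"
    using norm_real2_le[of v] unfolding v by simp
  also have "\<dots> \<le> \<bar>?w $ 2\<bar> + (\<bar>?w $ 1\<bar> + \<bar>?V\<bar> * \<bar>?w $ 2\<bar>)"
    using abs_triangle_ineq[of "?w $ 1" "?V * ?w $ 2"] by (simp add: abs_mult)
  also have "\<dots> \<le> norm ?w + (norm ?w + \<bar>?V\<bar> * norm ?w)"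
    by (intro add_mono mult_left_mono vb) auto
  also have "\<dots> \<le> K * norm ?w"
    using mult_right_mono[OF assms norm_ge_zero[of ?w]] by (simp add: algebra_simps)
  finally show "norm v \<le> K * norm ?w" .
qed

lemma row_transfer_nonzero:
  "v \<noteq> 0 \<Longrightarrow> v v* transfer_matrix f lam E x \<noteq> 0"
  using norm_row_transfer(2)[of E lam f x "\<bar>E - lam * f x\<bar> + 2" v] by auto

lemma row_cocycle_nonzero: "v \<noteq> 0 \<Longrightarrow> v v* cocycle f lam E n x \<noteq> 0"
proof (induction n arbitrary: x)
  case (Suc n)
  show ?case unfolding row_cocycle_Suc by (intro row_transfer_nonzero Suc)
qed simp

text \<open>
The indicator function of a cone around the direction that a large factor contracts, as a real number so that it
can be averaged.
\<close>

definition flat :: "real \<Rightarrow> real^2 \<Rightarrow> real" where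
  "flat kap v = of_bool (\<bar>v $ 1\<bar> < kap * \<bar>v $ 2\<bar>)"

text \<open>
A factor moves the first entry to the second, so it cannot shrink a non-flat vector by more than a factor 2; if
the image is non-flat as well, its first entry is at least \<open>kap\<close> times that old entry. In the
remaining case only the norm bound \<open>K\<close> of the inverse factor is available.
\<close>

lemma row_growth:
  assumes K: "\<bar>E - lam * f x\<bar> + 2 \<le> K" and kap: "kap \<ge> 1" and v: "v \<noteq> 0"
  defines "w \<equiv> v v* transfer_matrix f lam E x"
  shows "ln (norm w) - ln (norm v)
    \<ge> ln kap - 1 - (ln kap + ln K) * flat kap v - ln kap * flat kap w"
proof -
  have w0: "norm w > 0" "norm v > 0" using row_transfer_nonzero v by (auto simp: w_def)
  have K2: "K \<ge> 2" using K by linarith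
  have kap0: "ln kap \<ge> 0" using kap by simp
  show ?thesis
  proof (cases "\<bar>v $ 1\<bar> < kap * \<bar>v $ 2\<bar>")
    case True
    have "ln (norm v) \<le> ln (K * norm w)"
      using norm_row_transfer(2)[of E lam f x K v, OF K] w0 unfolding w_def by (intro ln_mono)
    then have "ln (norm w) - ln (norm v) \<ge> - ln K" using w0 K2 by (simp add: ln_mult)
    then show ?thesis using True kap0 by (auto simp: flat_def)
  next
    case False
    have "1 * \<bar>v $ 2\<bar> \<le> kap * \<bar>v $ 2\<bar>" using kap by (intro mult_right_mono) auto
    then have n: "norm v \<le> 2 * \<bar>v $ 1\<bar>" using False norm_real2_le[of v] by linarith
    have w2: "w $ 2 = - v $ 1" by (simp add: w_def row_transfer)
    have l2: "ln 2 \<le> (1::real)" using ln_le_minus_one[of "2::real"] by simp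
    have wn: "\<bar>w $ i\<bar> \<le> norm w" for i by (rule component_le_norm_cart)
    show ?thesis
    proof (cases "\<bar>w $ 1\<bar> < kap * \<bar>w $ 2\<bar>")
      case True
      have "norm v \<le> 2 * norm w" using n wn[of 2] w2 by simp
      then have "ln (norm v) \<le> ln (2 * norm w)" using w0 by simp
      then have "ln (norm v) \<le> 1 + ln (norm w)" using l2 w0 by (simp add: ln_mult)
      then show ?thesis using True False by (simp add: flat_def)
    next
      case False': False
      have "kap * norm v \<le> kap * (2 * \<bar>v $ 1\<bar>)" using n kap by (intro mult_left_mono) auto
      also have "\<dots> \<le> 2 * norm w" using False' wn[of 1] w2 by (simp add: algebra_simps)
      finally have "ln (kap * norm v) \<le> ln (2 * norm w)" using w0 kap by simp
      then have "ln kap + ln (norm v) \<le> 1 + ln (norm w)" using l2 w0 kap by (simp add: ln_mult)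
      then show ?thesis using False False' by (simp add: flat_def)
    qed
  qed
qed

section \<open>Expected logarithmic growth at strong coupling\<close>

locale steep_potential =
  fixes f :: "real \<Rightarrow> real" and M mu :: real
  assumes f_measurable [measurable]: "f \<in> borel_measurable borel"
    and f_bounded: "x \<in> {0..<1} \<Longrightarrow> \<bar>f x\<bar> \<le> M"
    and f_steep: "x \<in> {0..<1} \<Longrightarrow> y \<in> {0..<1} \<Longrightarrow> mu * \<bar>x - y\<bar> \<le> \<bar>f x - f y\<bar>"
    and mu_pos: "mu > 0"

text \<open>
Here \<open>kap\<close> is the flatness threshold and \<open>K\<close> bounds the norms of the factors and of their inverses. The number 128 is
4 times the number of points in a fibre of the fifth iterate: entries belonging to different points of such a fibre differ by at
least \<open>4 * kap\<close>. By \<open>growth_margin\<close>, a flatness probability of 3/32 leaves an expected growth of half of \<open>ln lam\<close> per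
step; by \<open>ln_K_le\<close>, the loss in 11 steps is at most \<open>12 * ln lam\<close>.
\<close>

locale strong_coupling = steep_potential +
  fixes lam kap K :: real
  assumes lam_ge_1: "lam \<ge> 1"
    and kap_le: "128 * kap \<le> lam * mu"
    and kap_ge_1: "kap \<ge> 1"
    and K_ge: "4 + 2 * lam * M \<le> K"
    and growth_margin: "ln lam / 2 \<le> ln kap - 1 - (3/32) * (2 * ln kap + ln K)"
    and ln_K_le: "11 * ln K \<le> 12 * ln lam"
    and ln_lam_ge_1: "ln lam \<ge> 1"
begin

definition "energies = {E. \<bar>E\<bar> \<le> 2 + lam * M}"

lemma K_bound:
  assumes "E \<in> energies" "x \<in> {0..<1}"
  shows "\<bar>E - lam * f x\<bar> + 2 \<le> K"
proof -
  have "\<bar>lam * f x\<bar> \<le> lam * M"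
    using f_bounded[OF assms(2)] lam_ge_1 by (simp add: abs_mult)
  then show ?thesis using assms(1) K_ge unfolding energies_def by simp
qed

lemma K_ge_2: "K \<ge> 2"
proof -
  have "M \<ge> 0" using f_bounded[of 0] by simp
  then have "lam * M \<ge> 0" using lam_ge_1 by simp
  then show ?thesis using K_ge by simp
qed

text \<open>
Steepness in the form that excludes two bad points of a fibre: \<open>c\<close> is the bad value of the diagonal entry and \<open>d\<close> the
spacing of the fibre.
\<close>

lemma steep_lam:
  assumes "x \<in> {0..<1}" "y \<in> {0..<1}" "d \<le> \<bar>x - y\<bar>" "\<bar>E - lam * f x - c\<bar> < b" "\<bar>E - lam * f y - c\<bar> < b"
  shows "128 * kap * d < 2 * b"
proof (cases "d \<le> 0")
  case True
  then have "128 * kap * d \<le> 0" using kap_ge_1 by (simp add: mult_nonneg_nonpos)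
  then show ?thesis using assms(4) by linarith
next
  case False
  have "128 * kap * d \<le> lam * mu * d" using kap_le False by (intro mult_right_mono) auto
  also have "\<dots> \<le> lam * (mu * \<bar>x - y\<bar>)" using assms(3) mu_pos lam_ge_1 by simp
  also have "\<dots> \<le> lam * \<bar>f x - f y\<bar>" using f_steep[OF assms(1,2)] lam_ge_1 by simp
  also have "\<dots> = \<bar>lam * f x - lam * f y\<bar>"
    using lam_ge_1 by (simp add: abs_mult flip: right_diff_distrib)
  also have "\<dots> < 2 * b" using assms(4,5) by linarith
  finally show ?thesis .
qed

definition resonant :: "real \<Rightarrow> real \<Rightarrow> real" where
  "resonant E x = of_bool (\<bar>E - lam * f x\<bar> < 2 * kap)"

lemma resonant_rare: assumes "y \<in> {0..<1}" shows "fibre_mean 5 (resonant E) y \<le> 1 / 32"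
proof -
  let ?S = "{i \<in> {..<32::nat}. \<bar>E - lam * f ((y + real i) / 32)\<bar> < 2 * kap}"
  have "card ?S \<le> Suc 0"
  proof (subst card_le_Suc0_iff_eq, simp, intro ballI)
    fix i j assume i: "i \<in> ?S" and j: "j \<in> ?S"
    show "i = j"
    proof (rule ccontr)
      assume "i \<noteq> j"
      then have "\<bar>real i - real j\<bar> \<ge> 1" by linarith
      then have d: "1/32 \<le> \<bar>(y + real i) / 32 - (y + real j) / 32\<bar>"
        by (simp add: abs_divide flip: diff_divide_distrib)
      have u: "(y + real i) / 32 \<in> {0..<1}" "(y + real j) / 32 \<in> {0..<1}"
        using i j assms by auto
      have "128 * kap * (1/32) < 2 * (2 * kap)"
        using i j by (intro steep_lam[OF u d, of E 0]) auto
      then show False by simp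
    qed
  qed
  moreover have "(\<Sum>i<32. resonant E ((y + real i) / 32)) = real (card ?S)"
    by (simp add: resonant_def sum_of_bool_eq Int_def)
  ultimately show ?thesis by (simp add: fibre_mean_grid)
qed

text \<open>
Whether the vector is flat after \<open>n + 1\<close> factors, as a function of the point \<open>x\<close> of the last of these factors. It is
evaluated on the fibre \<open>(doubling ^^ n) x = y\<close>, where \<open>y\<close> is the point of the first factor.
\<close>

definition flat_after :: "real \<Rightarrow> real^2 \<Rightarrow> nat \<Rightarrow> real \<Rightarrow> real" where
  "flat_after E s n x = flat kap ((s v* cocycle f lam E n x) v* transfer_matrix f lam E x)"

text \<open>
If the vector \<open>w\<close> produced by the factor at \<open>z\<close> is not flat, its second entry is negligible and only a resonant preimage of \<open>z\<close> can
make it flat. If \<open>w\<close> is flat, the ratio of its entries singles out one bad value of the diagonal entry, and the two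
preimages of \<open>z\<close> cannot both be near it.
\<close>

lemma flat_after_branches:
  assumes z: "z \<in> {0..<1}"
  shows "fibre_mean 1 (flat_after E s (Suc n)) z
    \<le> fibre_mean 1 (resonant E) z + 1/2 * flat_after E s n z"
proof -
  define w where "w = (s v* cocycle f lam E n z) v* transfer_matrix f lam E z"
  have fl: "flat_after E s (Suc n) x = of_bool (\<bar>(E - lam * f x) * w $ 1 + w $ 2\<bar> < kap * \<bar>w $ 1\<bar>)"
    if "doubling x = z" for x
    unfolding flat_after_def row_cocycle_Suc that w_def[symmetric]
    by (simp add: flat_def row_transfer)
  note br = doubling_branches[OF z]
  show ?thesis
  proof (cases "\<bar>w $ 1\<bar> < kap * \<bar>w $ 2\<bar>")
    case False
    have le: "flat_after E s (Suc n) x \<le> resonant E x" if "doubling x = z" for x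
    proof -
      have "\<bar>E - lam * f x\<bar> < 2 * kap" if *: "\<bar>(E - lam * f x) * w $ 1 + w $ 2\<bar> < kap * \<bar>w $ 1\<bar>"
      proof -
        have "1 * \<bar>w $ 2\<bar> \<le> kap * \<bar>w $ 2\<bar>" using kap_ge_1 by (intro mult_right_mono) auto
        moreover have "1 * \<bar>w $ 1\<bar> \<le> kap * \<bar>w $ 1\<bar>" using kap_ge_1 by (intro mult_right_mono) auto
        ultimately have "\<bar>w $ 2\<bar> \<le> kap * \<bar>w $ 1\<bar>" using False by linarith
        then have "\<bar>(E - lam * f x) * w $ 1\<bar> < 2 * kap * \<bar>w $ 1\<bar>" using * by linarith
        then show ?thesis unfolding abs_mult by (rule mult_right_less_imp_less) simp
      qed
      then show ?thesis by (simp add: fl[OF that] resonant_def)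
    qed
    have "flat_after E s n z \<ge> 0" by (simp add: flat_after_def flat_def)
    then show ?thesis using le[OF br(1)] le[OF br(2)] by (simp add: field_simps)
  next
    case True
    have "\<not> (\<bar>(E - lam * f (z/2)) * w $ 1 + w $ 2\<bar> < kap * \<bar>w $ 1\<bar> \<and>
             \<bar>(E - lam * f ((z+1)/2)) * w $ 1 + w $ 2\<bar> < kap * \<bar>w $ 1\<bar>)"
    proof
      have div: "\<bar>V - (- (w $ 2 / w $ 1))\<bar> < kap" if "\<bar>V * w $ 1 + w $ 2\<bar> < kap * \<bar>w $ 1\<bar>" for V
      proof -
        have w1: "w $ 1 \<noteq> 0" using that by auto
        then have "V * w $ 1 + w $ 2 = (V - (- (w $ 2 / w $ 1))) * w $ 1"
          by (simp add: field_simps)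
        then show ?thesis using that w1 by (simp add: abs_mult)
      qed
      \<comment> \<open>The preimages are at distance \<open>1/2\<close>, so their entries are at least \<open>64 * kap\<close> apart.\<close>
      have d: "1/2 \<le> \<bar>z/2 - (z+1)/2\<bar>" by (simp add: field_simps)
      assume "\<bar>(E - lam * f (z/2)) * w $ 1 + w $ 2\<bar> < kap * \<bar>w $ 1\<bar> \<and>
             \<bar>(E - lam * f ((z+1)/2)) * w $ 1 + w $ 2\<bar> < kap * \<bar>w $ 1\<bar>"
      from steep_lam[OF br(3,4) d div[OF conjunct1[OF this]] div[OF conjunct2[OF this]]]
      show False using kap_ge_1 by simp
    qed
    moreover have "flat_after E s n z = 1" using True by (simp add: flat_after_def flat_def w_def)
    moreover have "resonant E x \<ge> 0" for x by (simp add: resonant_def)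
    from this[of "z/2"] this[of "(z+1)/2"] have "0 \<le> resonant E (z/2) + resonant E ((z+1)/2)" by simp
    ultimately show ?thesis
      by (auto simp: fl[OF br(1)] fl[OF br(2)])
  qed
qed

text \<open>
Flatness probabilities obey \<open>p (n + 1) \<le> 1/32 + p n / 2\<close> as soon as five steps have made resonance rare, whatever the initial
vector and the initial point.
\<close>

lemma flat_after_rare:
  assumes y: "y \<in> {0..<1}"
  shows "fibre_mean (5 + k) (flat_after E s (5 + k)) y \<le> 2/32 + 1 / 2 ^ k"
proof (induction k)
  case 0
  have "fibre_mean 5 (flat_after E s 5) y \<le> fibre_mean 5 (\<lambda>_. 1) y"
    by (intro fibre_mean_mono y) (simp add: flat_after_def flat_def)
  then show ?case by simp
next
  case (Suc k)
  let ?n = "5 + k"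
  have "fibre_mean (1 + ?n) (flat_after E s (Suc ?n)) y
      = fibre_mean ?n (fibre_mean 1 (flat_after E s (Suc ?n))) y" by (rule fibre_mean_compose)
  also have "\<dots> \<le> fibre_mean ?n (\<lambda>z. fibre_mean 1 (resonant E) z + 1/2 * flat_after E s ?n z) y"
    by (intro fibre_mean_mono y flat_after_branches)
  also have "\<dots> = fibre_mean (1 + ?n) (resonant E) y + 1/2 * fibre_mean ?n (flat_after E s ?n) y"
    by (simp only: fibre_mean_add fibre_mean_cmult fibre_mean_compose)
  also have "fibre_mean (1 + ?n) (resonant E) y = fibre_mean (5 + Suc k) (resonant E) y"
    by (rule arg_cong[of "1 + ?n" "5 + Suc k" "\<lambda>i. fibre_mean i (resonant E) y"]) simp
  also have "\<dots> = fibre_mean (Suc k) (fibre_mean 5 (resonant E)) y" by (rule fibre_mean_compose)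
  also have "\<dots> \<le> fibre_mean (Suc k) (\<lambda>_. 1/32) y"
    by (intro fibre_mean_mono y resonant_rare)
  finally have "fibre_mean (1 + ?n) (flat_after E s (Suc ?n)) y
      \<le> 1/32 + 1/2 * fibre_mean ?n (flat_after E s ?n) y" by simp
  moreover have "(1::real) / 2 ^ Suc k = (1 / 2 ^ k) / 2" by simp
  ultimately show ?case using Suc by simp
qed

definition mean_log :: "real \<Rightarrow> real^2 \<Rightarrow> nat \<Rightarrow> real \<Rightarrow> real" where
  "mean_log E s n = fibre_mean n (\<lambda>x. ln (norm (s v* cocycle f lam E n x)))"

lemma mean_log_Suc:
  assumes y: "y \<in> {0..<1}"
  shows "mean_log E s (Suc n) y - mean_log E s n y =
    fibre_mean n (\<lambda>z. ln (norm ((s v* cocycle f lam E n z) v* transfer_matrix f lam E z))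
                      - ln (norm (s v* cocycle f lam E n z))) y"
  unfolding mean_log_def row_cocycle_Suc
  by (subst fibre_mean_doubling[OF y, of n
      "\<lambda>z. ln (norm ((s v* cocycle f lam E n z) v* transfer_matrix f lam E z))"])
     (simp add: fibre_mean_diff)

lemma ln_norm_transfer:
  assumes E: "E \<in> energies" and z: "z \<in> {0..<1}" and v: "v \<noteq> 0"
  shows "\<bar>ln (norm (v v* transfer_matrix f lam E z)) - ln (norm v)\<bar> \<le> ln K"
proof -
  let ?w = "v v* transfer_matrix f lam E z"
  have K: "\<bar>E - lam * f z\<bar> + 2 \<le> K" by (rule K_bound[OF E z])
  have w0: "norm ?w > 0" "norm v > 0" using row_transfer_nonzero v by auto
  have "ln (norm v) \<le> ln (K * norm ?w)"
    using norm_row_transfer(2)[of E lam f z K v, OF K] w0 by (intro ln_mono)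
  moreover have "ln (norm ?w) \<le> ln (K * norm v)"
    using norm_row_transfer(1)[of E lam f z K v, OF K] w0 by (intro ln_mono)
  ultimately show ?thesis using w0 K_ge_2 by (simp add: ln_mult)
qed

lemma ln_norm_cocycle:
  assumes E: "E \<in> energies" and v: "v \<noteq> 0"
  shows "\<bar>ln (norm (v v* cocycle f lam E n x)) - ln (norm v)\<bar> \<le> real n * ln K"
proof (induction n arbitrary: x)
  case (Suc n)
  have "\<bar>ln (norm (v v* cocycle f lam E (Suc n) x)) - ln (norm (v v* cocycle f lam E n (doubling x)))\<bar> \<le> ln K"
    unfolding row_cocycle_Suc
    by (intro ln_norm_transfer E doubling_in_unit row_cocycle_nonzero v)
  then show ?case using Suc[of "doubling x"] by (simp add: algebra_simps)
qed simp

lemma mean_log_Suc_ge: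
  assumes E: "E \<in> energies" and y: "y \<in> {0..<1}" and s: "s \<noteq> 0" and n: "n \<ge> 11"
  shows "mean_log E s (Suc n) y \<ge> mean_log E s n y + ln lam / 2"
proof -
  define k where "k = n - 6"
  have k: "n = 5 + Suc k" "k \<ge> 5" using n by (auto simp: k_def)
  have r: "fibre_mean (5 + j) (flat_after E s (5 + j)) y \<le> 3/32" if "j \<ge> 5" for j
  proof -
    have "(2::real) ^ 5 \<le> 2 ^ j" using that by (intro power_increasing) auto
    then have "(1::real) / 2 ^ j \<le> 1 / 32" by (simp add: field_simps)
    then show ?thesis using flat_after_rare[OF y, of j E s] by linarith
  qed
  have r1: "fibre_mean n (flat_after E s n) y \<le> 3/32" using r[of "Suc k"] k by simp
  have "fibre_mean n (\<lambda>z. flat kap (s v* cocycle f lam E n z)) y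
      = fibre_mean (Suc (5 + k)) (\<lambda>z. flat_after E s (5 + k) (doubling z)) y"
    unfolding k(1) by (simp only: flat_after_def row_cocycle_Suc add_Suc_right)
  also have "\<dots> = fibre_mean (5 + k) (flat_after E s (5 + k)) y" by (rule fibre_mean_doubling[OF y])
  finally have r2: "fibre_mean n (\<lambda>z. flat kap (s v* cocycle f lam E n z)) y \<le> 3/32"
    using r[of k] k by simp
  have lk: "ln kap \<ge> 0" "ln K \<ge> 0" using kap_ge_1 K_ge_2 by auto
  let ?w = "\<lambda>z. s v* cocycle f lam E n z"
  have "fibre_mean n (\<lambda>z. (ln kap - 1) - ((ln kap + ln K) * flat kap (?w z) + ln kap * flat_after E s n z)) y
    \<le> mean_log E s (Suc n) y - mean_log E s n y"
    unfolding mean_log_Suc[OF y]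
  proof (intro fibre_mean_mono y)
    fix z :: real assume z: "z \<in> {0..<1}"
    show "(ln kap - 1) - ((ln kap + ln K) * flat kap (?w z) + ln kap * flat_after E s n z)
      \<le> ln (norm (?w z v* transfer_matrix f lam E z)) - ln (norm (?w z))"
      using row_growth[of E lam f z K kap "?w z", OF K_bound[OF E z] kap_ge_1 row_cocycle_nonzero[OF s]]
      by (simp add: flat_after_def algebra_simps)
  qed
  moreover have "(ln kap + ln K) * fibre_mean n (\<lambda>z. flat kap (?w z)) y \<le> (ln kap + ln K) * (3/32)"
    using r2 lk by (intro mult_left_mono) auto
  moreover have "ln kap * fibre_mean n (flat_after E s n) y \<le> ln kap * (3/32)"
    using r1 lk by (intro mult_left_mono) auto
  moreover have "(3/32) * (2 * ln kap + ln K) = (ln kap + ln K) * (3/32) + ln kap * (3/32)"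
    by (simp add: algebra_simps)
  ultimately show ?thesis
    using growth_margin unfolding fibre_mean_diff fibre_mean_add fibre_mean_cmult fibre_mean_const
    by linarith
qed

text \<open>
Eleven steps may be lost: five until resonance is rare, five until the flatness recursion has settled, and one because the
growth in a step also involves the flatness before it. The 26 steps after them win \<open>13 * ln lam\<close>.
\<close>

lemma mean_log_growth:
  assumes E: "E \<in> energies" and y: "y \<in> {0..<1}" and s: "s \<noteq> 0"
  shows "mean_log E s 37 y \<ge> ln (norm s) + ln lam"
proof -
  have "fibre_mean 11 (\<lambda>x. ln (norm s) - 11 * ln K) y \<le> mean_log E s 11 y"
    unfolding mean_log_def
  proof (intro fibre_mean_mono y)
    fix x show "ln (norm s) - 11 * ln K \<le> ln (norm (s v* cocycle f lam E 11 x))"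
      using ln_norm_cocycle[OF E s, of 11 x] by (simp add: abs_le_iff)
  qed
  moreover have "mean_log E s (11 + k) y \<ge> mean_log E s 11 y + k * (ln lam / 2)" for k
  proof (induction k)
    case (Suc k)
    show ?case using mean_log_Suc_ge[OF E y s, of "11 + k"] Suc by (simp add: algebra_simps add_divide_distrib)
  qed simp
  from this[of 26] have "mean_log E s 37 y \<ge> mean_log E s 11 y + 13 * ln lam" by simp
  ultimately show ?thesis using ln_K_le by simp
qed

end

section \<open>Average contraction of the projective action\<close>

lemma exp_le_quadratic: "\<bar>z\<bar> \<le> 1 \<Longrightarrow> exp z \<le> 1 + z + z\<^sup>2" for z :: real
proof (cases "z \<ge> 0")
  case False
  define x where "x = - z"
  have x: "x \<ge> 0" using False by (simp add: x_def)
  have "1 \<le> 1 + x\<^sup>2 / 2 + x ^ 3 / 2 + x ^ 4 / 2" using x by simp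
  also have "\<dots> = (1 - x + x\<^sup>2) * (1 + x + x\<^sup>2 / 2)"
    by (simp add: algebra_simps power2_eq_square power3_eq_cube power4_eq_xxxx field_simps)
  also have "\<dots> \<le> (1 - x + x\<^sup>2) * exp x"
  proof (rule mult_left_mono)
    have "1 - x + x\<^sup>2 = (1/2 - x)\<^sup>2 + 3/4" by (simp add: power2_eq_square algebra_simps)
    then show "0 \<le> 1 - x + x\<^sup>2" by simp
  qed (rule exp_lower_Taylor_quadratic[OF x])
  finally have "exp (-x) \<le> 1 - x + x\<^sup>2" by (simp add: exp_minus field_simps)
  then show ?thesis by (simp add: x_def)
qed (simp add: exp_bound)

lemma fibre_mean_sum: "fibre_mean n (\<lambda>x. \<Sum>i\<in>A. h i x) y = (\<Sum>i\<in>A. fibre_mean n (h i) y)"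
  by (induction A rule: infinite_finite_induct) (simp_all add: fibre_mean_add)

definition wedge :: "real^2 \<Rightarrow> real^2 \<Rightarrow> real" where
  "wedge u v = u $ 1 * v $ 2 - u $ 2 * v $ 1"

text \<open>
The sine of the angle between two lines. As the factors have determinant 1, the numerator is invariant under the cocycle.
\<close>

definition proj_dist :: "real^2 \<Rightarrow> real^2 \<Rightarrow> real" where
  "proj_dist u v = \<bar>wedge u v\<bar> / (norm u * norm v)"

lemma wedge_transfer:
  "wedge (u v* transfer_matrix f lam E x) (v v* transfer_matrix f lam E x) = wedge u v"
  by (simp add: wedge_def row_transfer algebra_simps)

lemma wedge_cocycle:
  "wedge (u v* cocycle f lam E n x) (v v* cocycle f lam E n x) = wedge u v"
  by (induction n arbitrary: x) (simp_all add: row_cocycle_Suc wedge_transfer del: cocycle.simps(2))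

text \<open>
Each form is one of the two terms when the product of the squared norms is written as a sum of two squares.
\<close>

lemma two_form_le:
  fixes u v :: "real^2"
  shows "\<bar>u $ 1 * v $ 2 - u $ 2 * v $ 1\<bar> \<le> norm u * norm v"
    and "\<bar>u $ 1 * v $ 2 + u $ 2 * v $ 1\<bar> \<le> norm u * norm v"
    and "\<bar>u $ 2 * v $ 2 - u $ 1 * v $ 1\<bar> \<le> norm u * norm v"
proof -
  have *: "\<bar>p\<bar> \<le> norm u * norm v"
    if "((u $ 1)\<^sup>2 + (u $ 2)\<^sup>2) * ((v $ 1)\<^sup>2 + (v $ 2)\<^sup>2) = p\<^sup>2 + q\<^sup>2" for p q
  proof (rule power2_le_imp_le)
    show "\<bar>p\<bar>\<^sup>2 \<le> (norm u * norm v)\<^sup>2"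
      using that by (simp add: power_mult_distrib norm_real2_sq)
  qed simp
  show "\<bar>u $ 1 * v $ 2 - u $ 2 * v $ 1\<bar> \<le> norm u * norm v"
    by (rule *[where q="u $ 1 * v $ 1 + u $ 2 * v $ 2"]) algebra
  show "\<bar>u $ 1 * v $ 2 + u $ 2 * v $ 1\<bar> \<le> norm u * norm v"
    by (rule *[where q="u $ 1 * v $ 1 - u $ 2 * v $ 2"]) algebra
  show "\<bar>u $ 2 * v $ 2 - u $ 1 * v $ 1\<bar> \<le> norm u * norm v"
    by (rule *[where q="u $ 1 * v $ 2 + u $ 2 * v $ 1"]) algebra
qed

lemma proj_dist_nonneg: "0 \<le> proj_dist u v"
  by (simp add: proj_dist_def)

lemma proj_dist_le_1: "proj_dist u v \<le> 1"
proof (cases "norm u * norm v = 0")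
  case False
  then have "norm u * norm v > 0" by simp
  then show ?thesis using two_form_le(1)[of u v]
    by (simp add: proj_dist_def wedge_def divide_le_eq)
qed (auto simp: proj_dist_def)

lemma proj_dist_commute: "proj_dist u v = proj_dist v u"
proof -
  have "wedge u v = - wedge v u" by (simp add: wedge_def)
  then show ?thesis by (simp add: proj_dist_def mult.commute)
qed

text \<open>
The difference of \<open>(norm u')\<^sup>2 * (norm v)\<^sup>2\<close> and \<open>(norm v')\<^sup>2 * (norm u)\<^sup>2\<close>, with the primes denoting the images, vanishes when \<open>u\<close> and \<open>v\<close>
are parallel, so it has \<open>wedge u v\<close> as a factor.
\<close>

lemma ln_expansion_lipschitz:
  assumes K: "\<bar>E - lam * f x\<bar> + 2 \<le> K" and u: "u \<noteq> 0" and v: "v \<noteq> 0"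
  defines "g \<equiv> \<lambda>w. ln (norm (w v* transfer_matrix f lam E x)) - ln (norm w)"
  shows "\<bar>g u - g v\<bar> \<le> K ^ 4 * proj_dist u v"
proof -
  have main: "g u - g v \<le> K ^ 4 * proj_dist u v" if u: "u \<noteq> 0" and v: "v \<noteq> 0" for u v
  proof -
    let ?V = "E - lam * f x"
    define u' where "u' = u v* transfer_matrix f lam E x"
    define v' where "v' = v v* transfer_matrix f lam E x"
    have pos: "norm u > 0" "norm v > 0" "norm u' > 0" "norm v' > 0"
      using u v row_transfer_nonzero by (auto simp: u'_def v'_def)
    have K2: "K \<ge> 2" using K by simp
    let ?r = "((norm u')\<^sup>2 * (norm v)\<^sup>2) / ((norm v')\<^sup>2 * (norm u)\<^sup>2)"
    have comp: "u' $ 1 = ?V * u $ 1 + u $ 2" "u' $ 2 = - u $ 1" "v' $ 1 = ?V * v $ 1 + v $ 2" "v' $ 2 = - v $ 1"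
      by (simp_all add: u'_def v'_def row_transfer)
    have "(norm u')\<^sup>2 * (norm v)\<^sup>2 - (norm v')\<^sup>2 * (norm u)\<^sup>2
      = wedge u v * (?V\<^sup>2 * (u $ 1 * v $ 2 + u $ 2 * v $ 1) + 2 * ?V * (u $ 2 * v $ 2 - u $ 1 * v $ 1))"
      unfolding norm_real2_sq comp wedge_def by algebra
    also have "\<dots> \<le> \<bar>wedge u v\<bar> * (?V\<^sup>2 * (norm u * norm v) + 2 * \<bar>?V\<bar> * (norm u * norm v))"
    proof -
      have "\<bar>?V\<^sup>2 * (u $ 1 * v $ 2 + u $ 2 * v $ 1) + 2 * ?V * (u $ 2 * v $ 2 - u $ 1 * v $ 1)\<bar>
        \<le> \<bar>?V\<^sup>2 * (u $ 1 * v $ 2 + u $ 2 * v $ 1)\<bar> + \<bar>2 * ?V * (u $ 2 * v $ 2 - u $ 1 * v $ 1)\<bar>"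
        by (rule abs_triangle_ineq)
      also have "\<dots> \<le> ?V\<^sup>2 * (norm u * norm v) + 2 * \<bar>?V\<bar> * (norm u * norm v)"
        unfolding abs_mult abs_numeral abs_power2
        by (intro add_mono mult_left_mono two_form_le) auto
      finally have "\<bar>wedge u v * (?V\<^sup>2 * (u $ 1 * v $ 2 + u $ 2 * v $ 1) + 2 * ?V * (u $ 2 * v $ 2 - u $ 1 * v $ 1))\<bar>
        \<le> \<bar>wedge u v\<bar> * (?V\<^sup>2 * (norm u * norm v) + 2 * \<bar>?V\<bar> * (norm u * norm v))"
        unfolding abs_mult[of "wedge u v"] by (intro mult_left_mono) auto
      then show ?thesis by linarith
    qed
    also have "\<dots> = (?V\<^sup>2 + 2 * \<bar>?V\<bar>) * (\<bar>wedge u v\<bar> * (norm u * norm v))"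
      by (simp add: algebra_simps)
    also have "\<dots> \<le> K\<^sup>2 * (\<bar>wedge u v\<bar> * (norm u * norm v))"
    proof (rule mult_right_mono)
      have "\<bar>?V\<bar> * (\<bar>?V\<bar> + 2) \<le> K * K" using K by (intro mult_mono) auto
      then show "?V\<^sup>2 + 2 * \<bar>?V\<bar> \<le> K\<^sup>2" by (simp add: power2_eq_square distrib_left)
    qed simp
    also have "\<dots> = K\<^sup>2 * proj_dist u v * ((norm v)\<^sup>2 * (norm u)\<^sup>2)"
      using pos by (simp add: proj_dist_def power2_eq_square)
    also have "\<dots> \<le> K\<^sup>2 * proj_dist u v * ((K\<^sup>2 * (norm v')\<^sup>2) * (norm u)\<^sup>2)"
    proof -
      have "(norm v)\<^sup>2 \<le> (K * norm v')\<^sup>2"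
        using norm_row_transfer(2)[of E lam f x K v, OF K] by (intro power_mono) (auto simp: v'_def)
      then show ?thesis
        by (intro mult_left_mono mult_right_mono) (auto simp: power_mult_distrib proj_dist_nonneg)
    qed
    finally have "(norm u')\<^sup>2 * (norm v)\<^sup>2 \<le> (norm v')\<^sup>2 * (norm u)\<^sup>2
      + K ^ 4 * proj_dist u v * ((norm v')\<^sup>2 * (norm u)\<^sup>2)"
      by (simp add: algebra_simps power2_eq_square power4_eq_xxxx)
    then have "(norm u')\<^sup>2 * (norm v)\<^sup>2 \<le> (1 + K ^ 4 * proj_dist u v) * ((norm v')\<^sup>2 * (norm u)\<^sup>2)"
      by (simp add: algebra_simps)
    then have r: "?r \<le> 1 + K ^ 4 * proj_dist u v"
      using pos by (simp add: divide_le_eq)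
    have "2 * (g u - g v) = ln ?r"
      using pos by (simp add: g_def ln_div ln_mult ln_realpow flip: u'_def v'_def)
    also have "\<dots> \<le> ?r - 1" using pos by (intro ln_le_minus_one) simp
    also have "\<dots> \<le> K ^ 4 * proj_dist u v" using r by simp
    finally have "2 * (g u - g v) \<le> K ^ 4 * proj_dist u v" .
    moreover have "0 \<le> K ^ 4 * proj_dist u v" using K2 by (intro mult_nonneg_nonneg proj_dist_nonneg) simp
    moreover have "a \<le> b" if "2 * a \<le> b" "0 \<le> b" for a b :: real using that by linarith
    ultimately show ?thesis by blast
  qed
  show ?thesis using main[OF u v] main[OF v u] by (simp add: proj_dist_commute[of v u] abs_le_iff)
qed

text \<open>
Decay of the distance of two vectors is reduced to growth of each of them, by the inequality between the arithmetic and
geometric mean.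
\<close>

lemma proj_dist_decay:
  assumes "wedge u' v' = wedge u v" "u \<noteq> 0" "v \<noteq> 0" "u' \<noteq> 0" "v' \<noteq> 0"
  shows "proj_dist u' v' powr (t / 2)
    \<le> proj_dist u v powr (t / 2) / 2 *
      (norm u' powr (- t) / norm u powr (- t) + norm v' powr (- t) / norm v powr (- t))"
proof -
  define p where "p = (norm u' / norm u) powr (- t / 2)"
  define q where "q = (norm v' / norm v) powr (- t / 2)"
  have "proj_dist u' v' = proj_dist u v * (1 / (norm u' / norm u)) * (1 / (norm v' / norm v))"
    using assms by (simp add: proj_dist_def field_simps)
  also have "\<dots> powr (t / 2) = proj_dist u v powr (t / 2) * p * q"
    unfolding p_def q_def
    by (simp add: powr_mult powr_divide proj_dist_nonneg powr_minus divide_simps)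
  also have "\<dots> = proj_dist u v powr (t / 2) * (p * q)" by simp
  also have "\<dots> \<le> proj_dist u v powr (t / 2) * ((p\<^sup>2 + q\<^sup>2) / 2)"
  proof (rule mult_left_mono)
    show "p * q \<le> (p\<^sup>2 + q\<^sup>2) / 2" using sum_squares_bound[of p q] by simp
  qed simp
  also have "p\<^sup>2 = norm u' powr (- t) / norm u powr (- t)"
    unfolding p_def using assms by (simp add: power2_eq_square powr_divide flip: powr_add)
  also have "q\<^sup>2 = norm v' powr (- t) / norm v powr (- t)"
    unfolding q_def using assms by (simp add: power2_eq_square powr_divide flip: powr_add)
  finally show ?thesis by simp
qed

context strong_coupling begin

definition moment :: "real \<Rightarrow> real \<Rightarrow> real^2 \<Rightarrow> nat \<Rightarrow> real \<Rightarrow> real" where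
  "moment t E s n = fibre_mean n (\<lambda>x. norm (s v* cocycle f lam E n x) powr (- t))"

lemma moment_add:
  assumes "y \<in> {0..<1}"
  shows "moment t E s (m + n) y = fibre_mean n (\<lambda>z. moment t E (s v* cocycle f lam E n z) m z) y"
  unfolding moment_def row_cocycle_add
  using fibre_mean_markov[OF assms, of m n
      "\<lambda>z x. norm ((s v* cocycle f lam E n z) v* cocycle f lam E m x) powr (- t)"]
  by simp

lemma moment_crude:
  assumes E: "E \<in> energies" and y: "y \<in> {0..<1}" and s: "s \<noteq> 0" and t: "t > 0"
  shows "moment t E s n y \<le> exp (t * n * ln K) * norm s powr (- t)"
proof -
  have "moment t E s n y \<le> fibre_mean n (\<lambda>_. exp (t * n * ln K) * norm s powr (- t)) y"
    unfolding moment_def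
  proof (intro fibre_mean_mono y)
    fix x
    let ?w = "s v* cocycle f lam E n x"
    have w: "?w \<noteq> 0" by (rule row_cocycle_nonzero[OF s])
    have "ln (norm s) - n * ln K \<le> ln (norm ?w)"
      using ln_norm_cocycle[OF E s, of n x] by (simp add: abs_le_iff)
    from mult_left_mono[OF this, of t] t
    have "- t * ln (norm ?w) \<le> t * n * ln K + (- t) * ln (norm s)" by (simp add: algebra_simps)
    then show "norm ?w powr (- t) \<le> exp (t * n * ln K) * norm s powr (- t)"
      using s w by (simp add: powr_def flip: exp_add)
  qed
  then show ?thesis by simp
qed

text \<open>
With \<open>X\<close> the logarithmic growth over 37 steps, \<open>exp (- t * X)\<close> is at most \<open>1 - t * X + (t * X)\<^sup>2\<close>. The linear term wins
\<open>t * ln lam\<close> in the mean, and the bound on \<open>t\<close> keeps the quadratic term below half of that: 10952 is twice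
the square of 74, and \<open>74 * ln lam\<close> bounds the absolute value of \<open>X\<close>.
\<close>

lemma moment_contraction:
  assumes E: "E \<in> energies" and y: "y \<in> {0..<1}" and s: "s \<noteq> 0"
    and t: "t > 0" "10952 * t * ln lam \<le> 1"
  shows "moment t E s 37 y \<le> (1 - t * ln lam / 2) * norm s powr (- t)"
proof -
  let ?L = "ln lam" and ?w = "\<lambda>x. s v* cocycle f lam E 37 x" and ?S = "norm s powr (- t)"
  have "moment t E s 37 y
    \<le> fibre_mean 37 (\<lambda>x. ?S * ((1 + t * ln (norm s) + (74 * t * ?L)\<^sup>2) - t * ln (norm (?w x)))) y"
    unfolding moment_def
  proof (intro fibre_mean_mono y)
    fix x
    have w: "?w x \<noteq> 0" by (rule row_cocycle_nonzero[OF s])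
    define X where "X = ln (norm (?w x)) - ln (norm s)"
    have "37 * ln K \<le> 74 * ?L" using ln_K_le ln_lam_ge_1 by simp
    then have X: "\<bar>X\<bar> \<le> 74 * ?L"
      using ln_norm_cocycle[OF E s, of 37 x] by (simp add: X_def)
    from mult_left_mono[OF this, of t] t
    have tX: "\<bar>- t * X\<bar> \<le> 74 * t * ?L" by (simp add: abs_mult mult_ac)
    moreover have "74 * t * ?L \<le> 1" using t ln_lam_ge_1 by simp
    ultimately have "exp (- t * X) \<le> 1 + (- t * X) + (- t * X)\<^sup>2" by (intro exp_le_quadratic) simp
    also have "(- t * X)\<^sup>2 \<le> (74 * t * ?L)\<^sup>2" using tX by (rule abs_le_square_iff[THEN iffD1, OF order_trans]) simp
    finally have e: "exp (- t * X) \<le> 1 - t * X + (74 * t * ?L)\<^sup>2" by simp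
    have "norm (?w x) powr (- t) = ?S * exp (- t * X)"
      using s w by (simp add: powr_def X_def algebra_simps flip: exp_add)
    also have "\<dots> \<le> ?S * (1 - t * X + (74 * t * ?L)\<^sup>2)" using e by (intro mult_left_mono) auto
    finally show "norm (?w x) powr (- t) \<le> ?S * ((1 + t * ln (norm s) + (74 * t * ?L)\<^sup>2) - t * ln (norm (?w x)))"
      by (simp add: X_def algebra_simps)
  qed
  also have "\<dots> = ?S * ((1 + t * ln (norm s) + (74 * t * ?L)\<^sup>2) - t * mean_log E s 37 y)"
    unfolding mean_log_def by (simp only: fibre_mean_cmult fibre_mean_diff fibre_mean_const)
  also have "\<dots> \<le> ?S * (1 - t * ?L / 2)"
  proof (rule mult_left_mono)
    have "t * (ln (norm s) + ?L) \<le> t * mean_log E s 37 y"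
      using mean_log_growth[OF E y s] t by simp
    moreover have "(74 * t * ?L)\<^sup>2 = (10952 * t * ?L) * (t * ?L / 2)" by (simp add: power2_eq_square)
    moreover have "\<dots> \<le> 1 * (t * ?L / 2)" using t ln_lam_ge_1 by (intro mult_right_mono) auto
    ultimately show "(1 + t * ln (norm s) + (74 * t * ?L)\<^sup>2) - t * mean_log E s 37 y \<le> 1 - t * ?L / 2"
      by (simp add: algebra_simps)
  qed simp
  finally show ?thesis by (simp add: mult.commute)
qed

text \<open>
Cut the sum into blocks of 37 steps; by the Markov property each block is at most \<open>1 - t * ln lam / 2\<close> times the bound
for the preceding one.
\<close>

lemma moment_sum_bounded:
  assumes t: "t > 0" "10952 * t * ln lam \<le> 1"
  obtains C where "C > 0"
    "\<And>E y s k. E \<in> energies \<Longrightarrow> y \<in> {0..<1} \<Longrightarrow> s \<noteq> 0 \<Longrightarrow>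
       (\<Sum>j<k. moment t E s j y) \<le> C * norm s powr (- t)"
proof -
  define C0 where "C0 = (\<Sum>j<37::nat. exp (t * j * ln K))"
  define r where "r = t * ln lam / 2"
  have r: "r > 0" "r \<le> 1" using t ln_lam_ge_1 by (auto simp: r_def)
  have C0: "C0 > 0" unfolding C0_def by (intro sum_pos) (auto simp: lessThan_empty_iff)
  have C0_le: "C0 \<le> C0 / r" using C0 r by (simp add: le_divide_eq)
  have nn: "0 \<le> moment t E s j y" if "y \<in> {0..<1}" for E s j y
    using fibre_mean_mono[OF that, of j "\<lambda>_. 0" "\<lambda>x. norm (s v* cocycle f lam E j x) powr (- t)"]
    by (simp add: moment_def)
  have start: "(\<Sum>j<37. moment t E s j y) \<le> C0 * norm s powr (- t)"
    if "E \<in> energies" "y \<in> {0..<1}" "s \<noteq> 0" for E y s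
    unfolding C0_def sum_distrib_right by (intro sum_mono moment_crude that t)
  have "(\<Sum>j<k. moment t E s j y) \<le> C0 / r * norm s powr (- t)"
    if E: "E \<in> energies" and y: "y \<in> {0..<1}" and s: "s \<noteq> 0" for E y s k
    using y s
  proof (induction k arbitrary: y s rule: less_induct)
    case (less k)
    note y = less.prems(1) and s = less.prems(2)
    show ?case
    proof (cases "k \<le> 37")
      case True
      have "(\<Sum>j<k. moment t E s j y) \<le> (\<Sum>j<37. moment t E s j y)"
        using True by (intro sum_mono2 nn y) auto
      also have "\<dots> \<le> C0 * norm s powr (- t)" by (rule start[OF E y s])
      also have "\<dots> \<le> C0 / r * norm s powr (- t)" using C0_le by (intro mult_right_mono) auto
      finally show ?thesis .
    next
      case False
      define m where "m = k - 37"
      have k: "k = 37 + m" and m: "m < k" using False by (auto simp: m_def)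
      have "(\<Sum>j<k. moment t E s j y) = (\<Sum>j<37. moment t E s j y) + (\<Sum>j<m. moment t E s (j + 37) y)"
        unfolding k lessThan_atLeast0
        using sum.atLeastLessThan_concat[of 0 37 "37 + m" "\<lambda>j. moment t E s j y"]
          sum.shift_bounds_nat_ivl[of "\<lambda>j. moment t E s j y" 0 37 m]
        by (simp add: add.commute)
      also have "(\<Sum>j<m. moment t E s (j + 37) y)
          = fibre_mean 37 (\<lambda>z. \<Sum>j<m. moment t E (s v* cocycle f lam E 37 z) j z) y"
        by (simp add: moment_add[OF y] fibre_mean_sum)
      also have "\<dots> \<le> fibre_mean 37 (\<lambda>z. C0 / r * norm (s v* cocycle f lam E 37 z) powr (- t)) y"
        by (intro fibre_mean_mono y less.IH m row_cocycle_nonzero s)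
      also have "\<dots> = C0 / r * moment t E s 37 y" by (simp only: fibre_mean_cmult moment_def)
      also have "\<dots> \<le> C0 / r * ((1 - r) * norm s powr (- t))"
        using moment_contraction[OF E y s t] C0 r by (intro mult_left_mono) (auto simp: r_def)
      also have "(\<Sum>j<37. moment t E s j y) \<le> C0 * norm s powr (- t)" by (rule start[OF E y s])
      finally show ?thesis using r by (simp add: field_simps)
    qed
  qed
  moreover have "C0 / r > 0" using C0 r by simp
  ultimately show ?thesis by (intro that) auto
qed

definition log_ratio :: "real \<Rightarrow> real^2 \<Rightarrow> real^2 \<Rightarrow> nat \<Rightarrow> real \<Rightarrow> real" where
  "log_ratio E u v n x =
     (ln (norm (u v* cocycle f lam E n x)) - ln (norm u))
     - (ln (norm (v v* cocycle f lam E n x)) - ln (norm v))"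

text \<open>
The difference of the logarithmic growths of \<open>u\<close> and \<open>v\<close> is a sum over the steps, the \<open>j\<close>-th term being controlled by the
distance of the two images after \<open>j\<close> steps. The absolute value inside the mean is what later compares the
operator norm with the norm of a single row.
\<close>

lemma log_ratio_mean_bounded:
  assumes t: "t > 0" "10952 * t * ln lam \<le> 1"
  obtains C where "C > 0"
    "\<And>E y u v k. E \<in> energies \<Longrightarrow> y \<in> {0..<1} \<Longrightarrow> u \<noteq> 0 \<Longrightarrow> v \<noteq> 0 \<Longrightarrow>
       fibre_mean k (\<lambda>x. \<bar>log_ratio E u v k x\<bar>) y \<le> C * proj_dist u v powr (t / 2)"
proof -
  obtain C where C: "C > 0"
    "\<And>E y s k. E \<in> energies \<Longrightarrow> y \<in> {0..<1} \<Longrightarrow> s \<noteq> 0 \<Longrightarrow>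
       (\<Sum>j<k. moment t E s j y) \<le> C * norm s powr (- t)"
    using moment_sum_bounded[OF t] by blast
  have t2: "t / 2 \<le> 1"
  proof -
    have "10952 * t * 1 \<le> 10952 * t * ln lam" using t ln_lam_ge_1 by (intro mult_left_mono) auto
    then have "10952 * t \<le> 1" using t by linarith
    then show ?thesis by simp
  qed
  show ?thesis
  proof (rule that)
    show "K ^ 4 * C > 0" using C K_ge_2 by simp
    fix E y :: real and u v :: "real^2" and k
    assume E: "E \<in> energies" and y: "y \<in> {0..<1}" and u: "u \<noteq> 0" and v: "v \<noteq> 0"
    let ?C = "cocycle f lam E"
    let ?d = "\<lambda>j x. proj_dist (u v* ?C j x) (v v* ?C j x) powr (t / 2)"
    have step: "fibre_mean (Suc j) (\<lambda>x. \<bar>log_ratio E u v (Suc j) x\<bar>) y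
        \<le> fibre_mean j (\<lambda>x. \<bar>log_ratio E u v j x\<bar>) y + K ^ 4 * fibre_mean j (?d j) y" for j
    proof -
      have "fibre_mean (Suc j) (\<lambda>x. \<bar>log_ratio E u v (Suc j) x\<bar>) y
        \<le> fibre_mean (Suc j) (\<lambda>x. \<bar>log_ratio E u v j (doubling x)\<bar> + K ^ 4 * ?d j (doubling x)) y"
      proof (intro fibre_mean_mono y)
        fix x
        define z where "z = doubling x"
        have z: "z \<in> {0..<1}" unfolding z_def by (rule doubling_in_unit)
        define g where "g = (\<lambda>w. ln (norm (w v* transfer_matrix f lam E z)) - ln (norm w))"
        have "log_ratio E u v (Suc j) x = log_ratio E u v j z + (g (u v* ?C j z) - g (v v* ?C j z))"
          by (simp add: log_ratio_def row_cocycle_Suc g_def z_def del: cocycle.simps(2))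
        moreover have "\<bar>g (u v* ?C j z) - g (v v* ?C j z)\<bar> \<le> K ^ 4 * proj_dist (u v* ?C j z) (v v* ?C j z)"
          unfolding g_def
          by (intro ln_expansion_lipschitz K_bound E z row_cocycle_nonzero u v)
        moreover have "proj_dist (u v* ?C j z) (v v* ?C j z) \<le> ?d j z"
          using powr_mono'[of "t/2" 1 "proj_dist (u v* ?C j z) (v v* ?C j z)"] t2 t
            proj_dist_nonneg[of "u v* ?C j z" "v v* ?C j z"] proj_dist_le_1[of "u v* ?C j z" "v v* ?C j z"]
          by simp
        then have "K ^ 4 * proj_dist (u v* ?C j z) (v v* ?C j z) \<le> K ^ 4 * ?d j z"
          using K_ge_2 by (intro mult_left_mono) auto
        ultimately show "\<bar>log_ratio E u v (Suc j) x\<bar>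
          \<le> \<bar>log_ratio E u v j (doubling x)\<bar> + K ^ 4 * ?d j (doubling x)"
          unfolding z_def by linarith
      qed
      also have "\<dots> = fibre_mean j (\<lambda>x. \<bar>log_ratio E u v j x\<bar> + K ^ 4 * ?d j x) y"
        by (rule fibre_mean_doubling[OF y])
      finally show ?thesis by (simp only: fibre_mean_add fibre_mean_cmult)
    qed
    have "fibre_mean k (\<lambda>x. \<bar>log_ratio E u v k x\<bar>) y \<le> K ^ 4 * (\<Sum>j<k. fibre_mean j (?d j) y)"
    proof (induction k)
      case 0 show ?case by (simp add: log_ratio_def)
    next
      case (Suc k)
      show ?case using step[of k] Suc by (simp add: algebra_simps del: fibre_mean.simps(2))
    qed
    also have "\<dots> \<le> K ^ 4 * (\<Sum>j<k. proj_dist u v powr (t / 2) / 2 *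
        (moment t E u j y / norm u powr (- t) + moment t E v j y / norm v powr (- t)))"
    proof (intro mult_left_mono sum_mono)
      fix j
      have "fibre_mean j (?d j) y \<le> fibre_mean j (\<lambda>x. proj_dist u v powr (t / 2) / 2 *
        (1 / norm u powr (- t) * norm (u v* ?C j x) powr (- t)
          + 1 / norm v powr (- t) * norm (v v* ?C j x) powr (- t))) y"
        using proj_dist_decay[OF wedge_cocycle u v row_cocycle_nonzero[OF u] row_cocycle_nonzero[OF v]]
        by (intro fibre_mean_mono y) simp
      then show "fibre_mean j (?d j) y \<le> proj_dist u v powr (t / 2) / 2 *
        (moment t E u j y / norm u powr (- t) + moment t E v j y / norm v powr (- t))"
        by (simp only: fibre_mean_cmult fibre_mean_add moment_def divide_inverse mult_ac mult_1_left)
    qed (use K_ge_2 in simp)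
    also have "(\<Sum>j<k. proj_dist u v powr (t / 2) / 2 *
        (moment t E u j y / norm u powr (- t) + moment t E v j y / norm v powr (- t)))
      = proj_dist u v powr (t / 2) / 2 *
        ((\<Sum>j<k. moment t E u j y) / norm u powr (- t) + (\<Sum>j<k. moment t E v j y) / norm v powr (- t))"
      by (simp only: sum_divide_distrib sum.distrib[symmetric] sum_distrib_left)
    also have "\<dots> \<le> proj_dist u v powr (t / 2) / 2 * (C + C)"
      using C(2)[OF E y u, of k] C(2)[OF E y v, of k] u v
      by (intro mult_left_mono add_mono) (auto simp: divide_le_eq)
    finally show "fibre_mean k (\<lambda>x. \<bar>log_ratio E u v k x\<bar>) y \<le> K ^ 4 * C * proj_dist u v powr (t / 2)"
      using K_ge_2 by (simp add: mult_ac)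
  qed
qed

end

section \<open>Existence and regularity of the Lyapunov exponent\<close>

text \<open>
Comparing both \<open>a m / m\<close> and \<open>a n / n\<close> with \<open>a (m * n) / (m * n)\<close> shows that the quotients form a Cauchy sequence.
\<close>

lemma quasi_additive_convergent:
  fixes a :: "nat \<Rightarrow> real"
  assumes a: "\<And>m n. \<bar>a (m + n) - a m - a n\<bar> \<le> C"
  shows "convergent (\<lambda>n. a n / real n)"
proof -
  have C: "C \<ge> 0" using a[of 0 0] by linarith
  have mult: "\<bar>a (Suc k * n) - real (Suc k) * a n\<bar> \<le> real k * C" for k n
  proof (induction k)
    case (Suc k)
    have "\<bar>a (n + Suc k * n) - a n - a (Suc k * n)\<bar> \<le> C" by (rule a)
    then show ?case using Suc by (simp add: algebra_simps)
  qed simp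
  have ratio: "\<bar>a (m * n) / real (m * n) - a n / real n\<bar> \<le> C / real n" if "m > 0" "n > 0" for m n
  proof -
    obtain k where k: "m = Suc k" using gr0_implies_Suc[OF \<open>m > 0\<close>] by blast
    have "\<bar>a (m * n) - real m * a n\<bar> \<le> real m * C"
      using mult[of k n] C unfolding k by (simp add: algebra_simps)
    then have "\<bar>a (m * n) - real m * a n\<bar> / real (m * n) \<le> real m * C / real (m * n)"
      by (rule divide_right_mono) simp
    moreover have "a (m * n) / real (m * n) - a n / real n = (a (m * n) - real m * a n) / real (m * n)"
      using that by (simp add: field_simps)
    ultimately show ?thesis using that by (simp add: abs_divide)
  qed
  have "Cauchy (\<lambda>n. a n / real n)"
  proof (rule CauchyI)
    fix e :: real assume e: "e > 0"
    obtain N where N: "2 * C / e < real N" using reals_Archimedean2 by blast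
    have small: "C / real n < e / 2" if "n \<ge> Suc N" for n
    proof -
      have "2 * C / e < real n" using N that by linarith
      then show ?thesis using e that by (simp add: field_simps)
    qed
    show "\<exists>M. \<forall>m\<ge>M. \<forall>n\<ge>M. norm (a m / real m - a n / real n) < e"
    proof (intro exI[of _ "Suc N"] allI impI)
      fix m n assume mn: "Suc N \<le> m" "Suc N \<le> n"
      then have "m > 0" "n > 0" by auto
      from ratio[OF this] ratio[OF this(2,1)] small[OF mn(1)] small[OF mn(2)]
      show "norm (a m / real m - a n / real n) < e"
        unfolding real_norm_def mult.commute[of n m] by linarith
    qed
  qed
  then show ?thesis by (rule real_Cauchy_convergent)
qed

lemma bounded_linear_row: "bounded_linear (\<lambda>A :: real^2^2. v v* A)"
  by (auto intro!: linearI simp: linear_conv_bounded_linear[symmetric] vector_matrix_mult_add_rdistrib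
      vector_matrix_mult_def vec_eq_iff sum_distrib_left algebra_simps sum.distrib)

lemma bounded_linear_matrix: "bounded_linear ((*v) (A :: real^2^2))"
  by (simp add: linear_conv_bounded_linear[symmetric])

lemma norm_row_le_onorm: "norm (v v* A) \<le> norm v * onorm ((*v) (A :: real^2^2))"
proof (cases "v v* A = 0")
  case False
  have "norm (v v* A) * norm (v v* A) = inner v (A *v (v v* A))"
    by (simp add: dot_lmul_matrix[symmetric] power2_norm_eq_inner[symmetric] power2_eq_square)
  also have "\<dots> \<le> norm v * norm (A *v (v v* A))" by (rule norm_cauchy_schwarz)
  also have "\<dots> \<le> norm v * (onorm ((*v) A) * norm (v v* A))"
    by (intro mult_left_mono onorm bounded_linear_matrix) auto
  finally show ?thesis using False by simp
qed (simp add: onorm_pos_le bounded_linear_matrix)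

lemma onorm_le_rows: "onorm ((*v) (A :: real^2^2)) \<le> norm (axis 1 1 v* A) + norm (axis 2 1 v* A)"
proof (rule onorm_bound)
  fix x :: "real^2"
  have c: "\<bar>(A *v x) $ i\<bar> \<le> norm (axis i 1 v* A) * norm x" for i
  proof -
    have "(A *v x) $ i = inner (axis i 1 v* A) x" by (simp add: dot_lmul_matrix inner_axis')
    then show ?thesis using Cauchy_Schwarz_ineq2 by metis
  qed
  show "norm (A *v x) \<le> (norm (axis 1 1 v* A) + norm (axis 2 1 v* A)) * norm x"
    using norm_real2_le[of "A *v x"] c[of 1] c[of 2] by (simp add: algebra_simps)
qed simp

lemma continuous_onorm: "continuous_on UNIV (\<lambda>A :: real^2^2. onorm ((*v) A))"
proof -
  let ?N = "\<lambda>A :: real^2^2. onorm ((*v) A)"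
  let ?S = "\<lambda>A :: real^2^2. \<Sum>i\<in>UNIV. \<Sum>j\<in>UNIV. \<bar>A $ i $ j\<bar>"
  have le: "?N A \<le> ?N B + ?S (A - B)" for A B
  proof -
    have "?N A = onorm (\<lambda>x. B *v x + (A - B) *v x)"
      by (simp add: matrix_vector_mult_diff_rdistrib)
    also have "\<dots> \<le> ?N B + ?N (A - B)" by (intro onorm_triangle bounded_linear_matrix)
    finally show ?thesis using onorm_le_matrix_component_sum[of "A - B"] by linarith
  qed
  have "(?N \<longlongrightarrow> ?N B) (at B)" for B
  proof (rule LIM_zero_cancel, rule Lim_null_comparison)
    show "\<forall>\<^sub>F A in at B. norm (?N A - ?N B) \<le> ?S (A - B)"
    proof (intro always_eventually allI)
      fix A
      have "?S (B - A) = ?S (A - B)" by (simp add: abs_minus_commute)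
      then show "norm (?N A - ?N B) \<le> ?S (A - B)" using le[of A B] le[of B A] by (simp add: abs_le_iff)
    qed
    have "((\<lambda>A. ?S (A - B)) \<longlongrightarrow> ?S (B - B)) (at B)" by (intro tendsto_intros)
    then show "((\<lambda>A. ?S (A - B)) \<longlongrightarrow> 0) (at B)" by simp
  qed
  then show ?thesis by (simp add: continuous_on_eq_continuous_at continuous_at)
qed

lemma measurable_doubling [measurable]: "doubling \<in> borel_measurable borel"
  unfolding doubling_def[abs_def] frac_def by measurable

lemma measurable_doubling_funpow [measurable]: "doubling ^^ n \<in> borel_measurable borel"
  by (induction n) (auto intro: measurable_comp[of _ borel borel])

lemma measurable_cocycle_entry:
  assumes [measurable]: "f \<in> borel_measurable borel"
  shows "(\<lambda>x. cocycle f lam E n x $ i $ j) \<in> borel_measurable borel"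
proof (induction n arbitrary: i j)
  case (Suc n)
  have [measurable]: "(\<lambda>x. cocycle f lam E n x $ i $ j) \<in> borel_measurable borel" for i j by (rule Suc)
  have "(\<lambda>x. cocycle f lam E (Suc n) x $ i $ j) =
    (\<lambda>x. (if i = 1 then (E - lam * f ((doubling ^^ Suc n) x)) * cocycle f lam E n x $ 1 $ j - cocycle f lam E n x $ 2 $ j
          else cocycle f lam E n x $ 1 $ j))"
    using exhaust_2[of i]
    by (auto simp: fun_eq_iff matrix_matrix_mult_def sum_2 transfer_matrix_def)
  also have "\<dots> \<in> borel_measurable borel" by (cases "i = 1") (simp_all del: funpow.simps)
  finally show ?case .
qed simp

lemma measurable_cocycle:
  assumes "f \<in> borel_measurable borel"
  shows "cocycle f lam E n \<in> borel_measurable borel"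
  unfolding borel_measurable_euclidean_space[of "cocycle f lam E n"]
  using measurable_cocycle_entry[OF assms] by (auto simp: Basis_vec_def inner_axis)

lemma measurable_ln_norm_row [measurable]:
  assumes "f \<in> borel_measurable borel"
  shows "(\<lambda>x. ln (norm (v v* cocycle f lam E n x))) \<in> borel_measurable borel"
proof -
  have "(\<lambda>x. v v* cocycle f lam E n x) \<in> borel_measurable borel"
    by (rule borel_measurable_continuous_on[OF linear_continuous_on[OF bounded_linear_row] measurable_cocycle[OF assms]])
  then show ?thesis by measurable
qed

lemma measurable_ln_onorm [measurable]:
  assumes "f \<in> borel_measurable borel"
  shows "(\<lambda>x. ln (onorm ((*v) (cocycle f lam E n x)))) \<in> borel_measurable borel"
  using borel_measurable_continuous_on[OF continuous_onorm measurable_cocycle[OF assms]] by measurable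

context strong_coupling begin

lemma mean_log_Suc_first:
  assumes y: "y \<in> {0..<1}"
  shows "mean_log E s (Suc n) y = fibre_mean 1 (mean_log E (s v* transfer_matrix f lam E y) n) y"
proof -
  have "mean_log E s (Suc n) y = fibre_mean (n + 1)
      (\<lambda>x. ln (norm ((s v* cocycle f lam E 1 ((doubling ^^ n) x)) v* cocycle f lam E n x))) y"
    unfolding mean_log_def row_cocycle_add[symmetric] by simp
  also have "\<dots> = fibre_mean 1 (\<lambda>z. fibre_mean n
      (\<lambda>x. ln (norm ((s v* cocycle f lam E 1 z) v* cocycle f lam E n x))) z) y"
    by (rule fibre_mean_markov[OF y])
  also have "\<dots> = fibre_mean 1 (mean_log E (s v* transfer_matrix f lam E y) n) y"
    unfolding mean_log_def by (rule fibre_mean_cong[OF y]) simp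
  finally show ?thesis .
qed

text \<open>
The images of \<open>s\<close> under the factors for two energies have the same second entry \<open>- s $ 1\<close>, and their first entries differ by
\<open>(E - E') * s $ 1\<close>, so the difference is small relative to both norms.
\<close>

lemma transfer_energy:
  fixes E E' y :: real
  assumes s: "s \<noteq> 0"
  defines "p \<equiv> s v* transfer_matrix f lam E y" and "q \<equiv> s v* transfer_matrix f lam E' y"
  shows "proj_dist p q \<le> \<bar>E - E'\<bar>" and "\<bar>ln (norm p) - ln (norm q)\<bar> \<le> \<bar>E - E'\<bar>"
proof -
  have pos: "norm p > 0" "norm q > 0" using s row_transfer_nonzero by (auto simp: p_def q_def)
  have s1: "\<bar>s $ 1\<bar> \<le> norm p" "\<bar>s $ 1\<bar> \<le> norm q"
    using component_le_norm_cart[of p 2] component_le_norm_cart[of q 2]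
    by (simp_all add: p_def q_def row_transfer)
  have "wedge p q = - ((E - E') * (s $ 1 * s $ 1))"
    by (simp add: wedge_def p_def q_def row_transfer algebra_simps)
  then have "\<bar>wedge p q\<bar> = \<bar>E - E'\<bar> * (\<bar>s $ 1\<bar> * \<bar>s $ 1\<bar>)" by (simp only: abs_minus_cancel abs_mult)
  also have "\<dots> \<le> \<bar>E - E'\<bar> * (norm p * norm q)" by (intro mult_left_mono mult_mono s1) auto
  finally show "proj_dist p q \<le> \<bar>E - E'\<bar>" using pos by (simp add: proj_dist_def divide_le_eq)
  have pq: "norm (p - q) \<le> \<bar>E - E'\<bar> * \<bar>s $ 1\<bar>"
  proof -
    have "(p - q) $ 1 = (E - E') * s $ 1" "(p - q) $ 2 = 0"
      by (simp_all add: p_def q_def row_transfer algebra_simps)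
    then show ?thesis using norm_real2_le[of "p - q"] by (simp only: abs_mult abs_zero add_0_right)
  qed
  have one: "ln (norm a) - ln (norm b) \<le> \<bar>E - E'\<bar>"
    if "norm a > 0" "norm b > 0" "norm (a - b) \<le> \<bar>E - E'\<bar> * \<bar>s $ 1\<bar>" "\<bar>s $ 1\<bar> \<le> norm b" for a b :: "real^2"
  proof -
    have "\<bar>E - E'\<bar> * \<bar>s $ 1\<bar> \<le> \<bar>E - E'\<bar> * norm b" using that by (intro mult_left_mono) auto
    then have "norm a \<le> (1 + \<bar>E - E'\<bar>) * norm b"
      using norm_triangle_ineq2[of a b] that by (simp add: algebra_simps)
    then have "norm a / norm b \<le> 1 + \<bar>E - E'\<bar>" using that by (simp add: divide_le_eq)
    moreover have "ln (norm a) - ln (norm b) = ln (norm a / norm b)" using that by (simp add: ln_div)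
    moreover have "ln (norm a / norm b) \<le> norm a / norm b - 1" using that by (intro ln_le_minus_one) simp
    ultimately show ?thesis by linarith
  qed
  show "\<bar>ln (norm p) - ln (norm q)\<bar> \<le> \<bar>E - E'\<bar>"
    using one[OF pos pq s1(2)] one[OF pos(2,1)] pq s1(1) by (simp add: norm_minus_commute abs_le_iff)
qed

lemma mean_log_vector:
  assumes C: "\<And>E y u v k. E \<in> energies \<Longrightarrow> y \<in> {0..<1} \<Longrightarrow> u \<noteq> 0 \<Longrightarrow> v \<noteq> 0 \<Longrightarrow>
       fibre_mean k (\<lambda>x. \<bar>log_ratio E u v k x\<bar>) y \<le> C * proj_dist u v powr a"
    and E: "E \<in> energies" and y: "y \<in> {0..<1}" and uv: "u \<noteq> 0" "v \<noteq> 0"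
  shows "\<bar>(mean_log E u n y - ln (norm u)) - (mean_log E v n y - ln (norm v))\<bar> \<le> C * proj_dist u v powr a"
proof -
  have "(mean_log E u n y - ln (norm u)) - (mean_log E v n y - ln (norm v)) = fibre_mean n (log_ratio E u v n) y"
    unfolding log_ratio_def[abs_def] mean_log_def by (simp only: fibre_mean_diff fibre_mean_const)
  then show ?thesis using fibre_mean_abs[of n "log_ratio E u v n" y] C[OF E y uv, of n] by simp
qed

text \<open>
Replace the first factor met by the vector, which turns the vector slightly, and use \<open>mean_log_vector\<close> for the
remaining ones; then continue by induction from the new vector.
\<close>

lemma mean_log_energy:
  assumes C: "\<And>E y u v k. E \<in> energies \<Longrightarrow> y \<in> {0..<1} \<Longrightarrow> u \<noteq> 0 \<Longrightarrow> v \<noteq> 0 \<Longrightarrow>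
       fibre_mean k (\<lambda>x. \<bar>log_ratio E u v k x\<bar>) y \<le> C * proj_dist u v powr a"
    and a: "a > 0" and C0: "C > 0"
    and E: "E \<in> energies" "E' \<in> energies" and y: "y \<in> {0..<1}" and s: "s \<noteq> 0"
  shows "\<bar>mean_log E s n y - mean_log E' s n y\<bar> \<le> real n * (\<bar>E - E'\<bar> + C * \<bar>E - E'\<bar> powr a)"
  using y s
proof (induction n arbitrary: y s)
  case 0
  show ?case by (simp add: mean_log_def)
next
  case (Suc n)
  let ?d = "\<bar>E - E'\<bar>"
  define p where "p = s v* transfer_matrix f lam E y"
  define q where "q = s v* transfer_matrix f lam E' y"
  have nz: "p \<noteq> 0" "q \<noteq> 0" unfolding p_def q_def by (intro row_transfer_nonzero Suc.prems)+
  note te = transfer_energy[OF Suc.prems(2), of E y E', folded p_def q_def]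
  have "proj_dist p q powr a \<le> ?d powr a" using a te(1) proj_dist_nonneg by (intro powr_mono2) auto
  then have Cd: "C * proj_dist p q powr a \<le> C * ?d powr a" using C0 by simp
  have b: "\<bar>mean_log E p n z - mean_log E' q n z\<bar> \<le> real (Suc n) * (?d + C * ?d powr a)"
    if z: "z \<in> {0..<1}" for z
  proof -
    have "\<bar>mean_log E p n z - mean_log E q n z\<bar> \<le> ?d + C * ?d powr a"
      using mean_log_vector[OF C E(1) z nz, of n] te(2) Cd by linarith
    moreover have "\<bar>mean_log E q n z - mean_log E' q n z\<bar> \<le> real n * (?d + C * ?d powr a)"
      by (rule Suc.IH[OF z nz(2)])
    moreover have "real (Suc n) * (?d + C * ?d powr a)
        = (?d + C * ?d powr a) + real n * (?d + C * ?d powr a)" by (simp add: algebra_simps)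
    ultimately show ?thesis by linarith
  qed
  have "mean_log E s (Suc n) y - mean_log E' s (Suc n) y
      = fibre_mean 1 (\<lambda>z. mean_log E p n z - mean_log E' q n z) y"
    unfolding mean_log_Suc_first[OF Suc.prems(1)] p_def q_def by (rule fibre_mean_diff[symmetric])
  also have "\<bar>\<dots>\<bar> \<le> fibre_mean 1 (\<lambda>z. \<bar>mean_log E p n z - mean_log E' q n z\<bar>) y" by (rule fibre_mean_abs)
  also have "\<dots> \<le> fibre_mean 1 (\<lambda>_. real (Suc n) * (?d + C * ?d powr a)) y"
    by (intro fibre_mean_mono Suc.prems b)
  finally show ?case by (simp only: fibre_mean_const)
qed

lemma bounded_borel_ln_norm_row:
  assumes "E \<in> energies" "v \<noteq> 0"
  shows "bounded_borel (\<lambda>x. ln (norm (v v* cocycle f lam E n x)))"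
proof (rule bounded_borelI)
  show "\<bar>ln (norm (v v* cocycle f lam E n x))\<bar> \<le> \<bar>ln (norm v)\<bar> + real n * ln K" for x
    using ln_norm_cocycle[OF assms, of n x] by linarith
qed (rule measurable_ln_norm_row[OF f_measurable])

abbreviation "e1 \<equiv> axis 1 1 :: real^2"
abbreviation "e2 \<equiv> axis 2 1 :: real^2"

text \<open>
The rows of the cocycle are the images of the unit vectors, and \<open>log_ratio\<close> compares their lengths.
\<close>

lemma ln_onorm_row:
  "ln (norm (e1 v* cocycle f lam E n x)) \<le> ln (onorm ((*v) (cocycle f lam E n x)))"
  "ln (onorm ((*v) (cocycle f lam E n x))) \<le>
     ln (norm (e1 v* cocycle f lam E n x)) + (\<bar>log_ratio E e2 e1 n x\<bar> + ln 2)"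
proof -
  let ?A = "cocycle f lam E n x"
  let ?r = "norm (e1 v* ?A)" and ?s = "norm (e2 v* ?A)"
  have e: "e1 \<noteq> 0" "e2 \<noteq> 0" by (simp_all add: axis_eq_0_iff)
  have pos: "?r > 0" "?s > 0" using row_cocycle_nonzero[OF e(1)] row_cocycle_nonzero[OF e(2)] by simp_all
  have le: "?r \<le> onorm ((*v) ?A)" using norm_row_le_onorm[of e1 ?A] by simp
  then show "ln ?r \<le> ln (onorm ((*v) ?A))" using pos by (intro ln_mono)
  have "onorm ((*v) ?A) \<le> 2 * max ?r ?s" using onorm_le_rows[of ?A] by (simp add: max_def)
  moreover have "0 < onorm ((*v) ?A)" using pos(1) le by linarith
  ultimately have "ln (onorm ((*v) ?A)) \<le> ln (2 * max ?r ?s)" by (rule ln_mono)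
  also have "\<dots> = ln 2 + ln (max ?r ?s)"
  proof (rule ln_mult_pos)
    show "0 < max ?r ?s" using pos(1) by (rule less_le_trans) simp
  qed simp
  also have "ln (max ?r ?s) \<le> ln ?r + \<bar>ln ?s - ln ?r\<bar>" using pos by (auto simp: max_def)
  also have "ln ?s - ln ?r = log_ratio E e2 e1 n x" by (simp add: log_ratio_def)
  finally show "ln (onorm ((*v) ?A)) \<le> ln ?r + (\<bar>log_ratio E e2 e1 n x\<bar> + ln 2)" by simp
qed

lemma lyapunov_hoelder:
  assumes t: "t > 0" "10952 * t * ln lam \<le> 1"
  obtains C where "C > 0"
    "\<And>E E'. E \<in> energies \<Longrightarrow> E' \<in> energies \<Longrightarrow>
       \<bar>lyapunov f lam E - lyapunov f lam E'\<bar> \<le> \<bar>E - E'\<bar> + C * \<bar>E - E'\<bar> powr (t / 2)"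
proof -
  obtain C where C0: "C > 0" and C: "\<And>E y u v k. E \<in> energies \<Longrightarrow> y \<in> {0..<1} \<Longrightarrow> u \<noteq> 0 \<Longrightarrow> v \<noteq> 0 \<Longrightarrow>
       fibre_mean k (\<lambda>x. \<bar>log_ratio E u v k x\<bar>) y \<le> C * proj_dist u v powr (t / 2)"
    using log_ratio_mean_bounded[OF t] by blast
  have e: "e1 \<noteq> 0" "e2 \<noteq> 0" by (simp_all add: axis_eq_0_iff)
  have ln1: "ln (norm e1) = 0" by simp
  have C1: "C * proj_dist u v powr (t / 2) \<le> C" for u v
  proof -
    have "proj_dist u v powr (t / 2) \<le> 1 powr (t / 2)"
      using t by (intro powr_mono2 proj_dist_nonneg proj_dist_le_1) auto
    then show ?thesis using C0 by simp
  qed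
  define F where "F = (\<lambda>E n. circle_mean (mean_log E e1 n))"
  define P where "P = (\<lambda>E n. circle_mean (\<lambda>x. ln (onorm ((*v) (cocycle f lam E n x)))))"
  have ob: "bounded_borel (mean_log E e1 n)" if "E \<in> energies" for E n
    unfolding mean_log_def by (intro bounded_borel_fibre_mean bounded_borel_ln_norm_row that e)
  \<comment> \<open>Given the first \<open>n\<close> steps, the vector reached grows in the next \<open>m\<close> steps like \<open>e1\<close>, up to \<open>C\<close>.\<close>
  have quasi: "\<bar>F E (m + n) - F E m - F E n\<bar> \<le> C" if E: "E \<in> energies" for E m n
  proof -
    have pw: "\<bar>mean_log E e1 (m + n) y - (mean_log E e1 n y + fibre_mean n (mean_log E e1 m) y)\<bar> \<le> C"
      if y: "y \<in> {0..<1}" for y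
    proof -
      let ?w = "\<lambda>z. e1 v* cocycle f lam E n z"
      have "mean_log E e1 (m + n) y = fibre_mean n (\<lambda>z. mean_log E (?w z) m z) y"
        unfolding mean_log_def row_cocycle_add
        by (rule fibre_mean_markov[OF y, of m n "\<lambda>z x. ln (norm (?w z v* cocycle f lam E m x))"])
      moreover have "mean_log E e1 n y = fibre_mean n (\<lambda>z. ln (norm (?w z))) y" by (simp add: mean_log_def)
      moreover have "fibre_mean n (\<lambda>z. mean_log E (?w z) m z - (ln (norm (?w z)) + mean_log E e1 m z)) y
        = fibre_mean n (\<lambda>z. mean_log E (?w z) m z) y
          - (fibre_mean n (\<lambda>z. ln (norm (?w z))) y + fibre_mean n (mean_log E e1 m) y)"
        unfolding fibre_mean_diff fibre_mean_add ..
      ultimately have eq: "mean_log E e1 (m + n) y - (mean_log E e1 n y + fibre_mean n (mean_log E e1 m) y)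
         = fibre_mean n (\<lambda>z. mean_log E (?w z) m z - (ln (norm (?w z)) + mean_log E e1 m z)) y"
        by linarith
      have "\<bar>mean_log E e1 (m + n) y - (mean_log E e1 n y + fibre_mean n (mean_log E e1 m) y)\<bar>
        \<le> fibre_mean n (\<lambda>z. \<bar>mean_log E (?w z) m z - (ln (norm (?w z)) + mean_log E e1 m z)\<bar>) y"
        unfolding eq by (rule fibre_mean_abs)
      also have "\<dots> \<le> fibre_mean n (\<lambda>_. C) y"
      proof (intro fibre_mean_mono y)
        fix z :: real assume z: "z \<in> {0..<1}"
        show "\<bar>mean_log E (?w z) m z - (ln (norm (?w z)) + mean_log E e1 m z)\<bar> \<le> C"
        proof -
          have "?w z \<noteq> 0" by (rule row_cocycle_nonzero[OF e(1)])
          from mean_log_vector[OF C E z this e(1), of m] C1[of "?w z" e1] ln1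
          show ?thesis by linarith
        qed
      qed
      finally show ?thesis unfolding fibre_mean_const .
    qed
    have "\<bar>circle_mean (mean_log E e1 (m + n)) - circle_mean (\<lambda>y. mean_log E e1 n y + fibre_mean n (mean_log E e1 m) y)\<bar> \<le> C"
      by (rule circle_mean_abs_diff_le[OF ob[OF E] bounded_borel_add[OF ob[OF E, of n] bounded_borel_fibre_mean[OF ob[OF E, of m], of n]] pw])
    moreover have "circle_mean (\<lambda>y. mean_log E e1 n y + fibre_mean n (mean_log E e1 m) y) = F E n + F E m"
      unfolding F_def circle_mean_add[OF ob[OF E] bounded_borel_fibre_mean[OF ob[OF E]]] circle_mean_fibre_mean[OF ob[OF E]] ..
    ultimately show ?thesis unfolding F_def by linarith
  qed
  \<comment> \<open>The logarithmic lengths of the two rows differ by a bounded amount in the mean.\<close>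
  have close: "\<bar>P E n - F E n\<bar> \<le> C + ln 2" if E: "E \<in> energies" for E n
  proof -
    let ?o = "\<lambda>x. ln (onorm ((*v) (cocycle f lam E n x)))" and ?r = "\<lambda>x. ln (norm (e1 v* cocycle f lam E n x))"
    have oo: "bounded_borel ?o"
    proof -
      obtain B1 where 1: "\<And>x. x \<in> {0..<1} \<Longrightarrow> \<bar>?r x\<bar> \<le> B1" using bounded_borelE[OF bounded_borel_ln_norm_row[OF E e(1), of n]] by metis
      obtain B2 where 2: "\<And>x. x \<in> {0..<1} \<Longrightarrow> \<bar>ln (norm (e2 v* cocycle f lam E n x))\<bar> \<le> B2"
        using bounded_borelE[OF bounded_borel_ln_norm_row[OF E e(2), of n]] by metis
      have "\<bar>?o x\<bar> \<le> B1 + (B1 + B2 + ln 2)" if "x \<in> {0..<1}" for x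
        using ln_onorm_row[where E=E and n=n and x=x] 1[OF that] 2[OF that] ln_ge_zero[of 2]
        by (simp add: log_ratio_def)
      then show ?thesis by (rule bounded_borelI[OF measurable_ln_onorm[OF f_measurable]])
    qed
    have "\<bar>fibre_mean n ?o y - mean_log E e1 n y\<bar> \<le> C + ln 2" if y: "y \<in> {0..<1}" for y
    proof -
      have "fibre_mean n ?r y \<le> fibre_mean n ?o y" by (intro fibre_mean_mono y ln_onorm_row)
      moreover have "fibre_mean n ?o y \<le> fibre_mean n (\<lambda>x. ?r x + (\<bar>log_ratio E e2 e1 n x\<bar> + ln 2)) y"
        by (intro fibre_mean_mono y ln_onorm_row)
      moreover have "fibre_mean n (\<lambda>x. \<bar>log_ratio E e2 e1 n x\<bar>) y \<le> C"
        using C[OF E y e(2,1), of n] C1[of e2 e1] by linarith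
      ultimately show ?thesis unfolding mean_log_def fibre_mean_add fibre_mean_const by linarith
    qed
    from circle_mean_abs_diff_le[OF bounded_borel_fibre_mean[OF oo] ob[OF E] this] show ?thesis
      by (simp add: circle_mean_fibre_mean[OF oo] P_def F_def)
  qed
  have lim: "(\<lambda>n. F E n / real n) \<longlonglongrightarrow> lyapunov f lam E" if E: "E \<in> energies" for E
  proof -
    obtain l where l: "(\<lambda>n. F E n / real n) \<longlonglongrightarrow> l"
      using quasi_additive_convergent[OF quasi[OF E]] by (auto simp: convergent_def)
    have "(\<lambda>n. (P E n - F E n) / real n) \<longlonglongrightarrow> 0"
    proof (rule Lim_null_comparison)
      show "\<forall>\<^sub>F n in sequentially. norm ((P E n - F E n) / real n) \<le> (C + ln 2) / real n"
        using close[OF E] by (intro always_eventually allI) (simp add: divide_right_mono)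
      show "(\<lambda>n. (C + ln 2) / real n) \<longlonglongrightarrow> 0" by (rule lim_const_over_n)
    qed
    from tendsto_add[OF l this] have "(\<lambda>n. (1 / real n) * P E n) \<longlonglongrightarrow> l"
      by (simp add: diff_divide_distrib)
    then have "lyapunov f lam E = l" unfolding lyapunov_def P_def circle_mean_def by (rule limI)
    then show ?thesis using l by simp
  qed
  show ?thesis
  proof (rule that[OF C0])
    fix E E' assume E: "E \<in> energies" "E' \<in> energies"
    let ?b = "\<bar>E - E'\<bar> + C * \<bar>E - E'\<bar> powr (t / 2)"
    have t2: "t / 2 > 0" using t by simp
    have "\<bar>F E n - F E' n\<bar> \<le> real n * ?b" for n
      unfolding F_def
      by (rule circle_mean_abs_diff_le[OF ob[OF E(1)] ob[OF E(2)]], rule mean_log_energy[OF C t2 C0 E _ e(1)])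
    then have b: "\<bar>F E n / real n - F E' n / real n\<bar> \<le> ?b" if "n \<ge> 1" for n
      using that by (simp add: divide_le_eq mult.commute flip: diff_divide_distrib)
    have "(\<lambda>n. \<bar>F E n / real n - F E' n / real n\<bar>) \<longlonglongrightarrow> \<bar>lyapunov f lam E - lyapunov f lam E'\<bar>"
      by (intro tendsto_intros lim E)
    then show "\<bar>lyapunov f lam E - lyapunov f lam E'\<bar> \<le> ?b"
      by (rule LIMSEQ_le_const2) (use b in blast)
  qed
qed

end

section \<open>The spectrum is bounded\<close>

lemma ell2_iff_bounded:
  "u \<in> ell2 \<longleftrightarrow> (\<exists>B. \<forall>N. L2_set (\<lambda>n. cmod (u n)) {..<N} \<le> B)"
proof
  assume "u \<in> ell2"
  then have s: "summable (\<lambda>n. (cmod (u n))\<^sup>2)" by (simp add: ell2_def)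
  show "\<exists>B. \<forall>N. L2_set (\<lambda>n. cmod (u n)) {..<N} \<le> B"
    unfolding L2_set_def
    using sum_le_suminf[OF s] by (intro exI[of _ "sqrt (\<Sum>n. (cmod (u n))\<^sup>2)"] allI real_sqrt_le_mono) auto
next
  assume "\<exists>B. \<forall>N. L2_set (\<lambda>n. cmod (u n)) {..<N} \<le> B"
  then obtain B where B: "\<And>N. L2_set (\<lambda>n. cmod (u n)) {..<N} \<le> B" by blast
  have "(\<Sum>n<N. (cmod (u n))\<^sup>2) \<le> B\<^sup>2" for N
    using power_mono[OF B[of N], of 2] by (simp add: L2_set_def sum_nonneg)
  then have "(\<Sum>n\<le>N. (cmod (u n))\<^sup>2) \<le> B\<^sup>2" for N
    unfolding lessThan_Suc_atMost[symmetric] by blast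
  then show "u \<in> ell2"
    unfolding ell2_def by (intro CollectI bounded_imp_summable[where B="B\<^sup>2"]) auto
qed

lemma L2_set_le_ell2_norm:
  assumes "u \<in> ell2" shows "L2_set (\<lambda>n. cmod (u n)) {..<N} \<le> ell2_norm u"
  using assms unfolding L2_set_def ell2_norm_def ell2_def
  by (intro real_sqrt_le_mono sum_le_suminf) auto

lemma ell2_norm_le:
  assumes "\<And>N. L2_set (\<lambda>n. cmod (u n)) {..<N} \<le> B"
  shows "u \<in> ell2" "ell2_norm u \<le> B"
proof -
  show u: "u \<in> ell2" using assms by (auto simp: ell2_iff_bounded)
  have B: "B \<ge> 0" using assms[of 0] by simp
  have "(\<Sum>n<N. (cmod (u n))\<^sup>2) \<le> B\<^sup>2" for N
    using power_mono[OF assms[of N], of 2] by (simp add: L2_set_def sum_nonneg)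
  then have "(\<Sum>n. (cmod (u n))\<^sup>2) \<le> B\<^sup>2"
    using u by (intro suminf_le_const) (auto simp: ell2_def)
  then show "ell2_norm u \<le> B" unfolding ell2_norm_def using B by (intro real_le_lsqrt) auto
qed

lemma ell2_norm_nonneg: "u \<in> ell2 \<Longrightarrow> 0 \<le> ell2_norm u"
  using L2_set_le_ell2_norm[of u 0] by simp

lemma cmod_le_ell2_norm: "u \<in> ell2 \<Longrightarrow> cmod (u n) \<le> ell2_norm u"
  using member_le_L2_set[of "{..<Suc n}" n "\<lambda>n. cmod (u n)"] L2_set_le_ell2_norm[of u "Suc n"] by simp

lemma schroedinger_bound:
  assumes b: "\<And>n. \<bar>f ((doubling ^^ n) x)\<bar> \<le> M" and lam: "lam \<ge> 0" and u: "u \<in> ell2"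
  shows "schroedinger f lam x u \<in> ell2"
    and "ell2_norm (schroedinger f lam x u) \<le> (2 + lam * M) * ell2_norm u"
proof -
  have M: "M \<ge> 0" using b[of 0] by simp
  have "L2_set (\<lambda>n. cmod (schroedinger f lam x u n)) {..<N} \<le> (2 + lam * M) * ell2_norm u" for N
  proof -
    let ?v = "\<lambda>n. if n = 0 then 0 else cmod (u (n - 1))"
    have "cmod (schroedinger f lam x u n) \<le> (cmod (u (n + 1)) + ?v n) + lam * M * cmod (u n)" for n
    proof -
      have "lam * \<bar>f ((doubling ^^ n) x)\<bar> * cmod (u n) \<le> lam * M * cmod (u n)"
        using b[of n] lam by (intro mult_right_mono mult_left_mono) auto
      then show ?thesis
        unfolding schroedinger_def
        by (intro order_trans[OF norm_triangle_ineq] add_mono)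
           (auto simp: norm_mult lam intro: norm_triangle_ineq)
    qed
    then have "L2_set (\<lambda>n. cmod (schroedinger f lam x u n)) {..<N}
      \<le> L2_set (\<lambda>n. (cmod (u (n + 1)) + ?v n) + lam * M * cmod (u n)) {..<N}"
      by (intro L2_set_mono) auto
    also have "\<dots> \<le> (L2_set (\<lambda>n. cmod (u (n + 1))) {..<N} + L2_set ?v {..<N})
        + L2_set (\<lambda>n. lam * M * cmod (u n)) {..<N}"
      by (intro order_trans[OF L2_set_triangle_ineq] add_mono L2_set_triangle_ineq) simp
    also have "L2_set (\<lambda>n. cmod (u (n + 1))) {..<N} \<le> L2_set (\<lambda>n. cmod (u n)) {..<Suc N}"
      unfolding L2_set_def by (subst sum.lessThan_Suc_shift) simp
    also have "\<dots> \<le> ell2_norm u" by (rule L2_set_le_ell2_norm[OF u])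
    also have "L2_set ?v {..<N} \<le> L2_set ?v {..<Suc N}"
      unfolding L2_set_def by (intro real_sqrt_le_mono sum_mono2) auto
    also have "\<dots> = L2_set (\<lambda>n. cmod (u n)) {..<N}"
      unfolding L2_set_def by (subst sum.lessThan_Suc_shift) simp
    also have "\<dots> \<le> ell2_norm u" by (rule L2_set_le_ell2_norm[OF u])
    also have "L2_set (\<lambda>n. lam * M * cmod (u n)) {..<N} = lam * M * L2_set (\<lambda>n. cmod (u n)) {..<N}"
      using L2_set_right_distrib[of "lam * M" "\<lambda>n. cmod (u n)" "{..<N}"] lam M by simp
    also have "\<dots> \<le> lam * M * ell2_norm u"
      using L2_set_le_ell2_norm[OF u] lam M by (intro mult_left_mono) auto
    finally show ?thesis by (simp add: algebra_simps)
  qed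
  then show "schroedinger f lam x u \<in> ell2"
    and "ell2_norm (schroedinger f lam x u) \<le> (2 + lam * M) * ell2_norm u"
    by (blast intro: ell2_norm_le)+
qed

text \<open>
Completeness of the space, in the form needed for a Neumann series: a series of sequences whose norms have a convergent majorant
converges entrywise to a square summable sequence.
\<close>

lemma ell2_series:
  fixes w :: "nat \<Rightarrow> nat \<Rightarrow> complex"
  assumes w: "\<And>k. w k \<in> ell2" and B: "\<And>k. ell2_norm (w k) \<le> b k" and b: "summable b"
  shows "summable (\<lambda>k. w k n)" and "(\<lambda>n. \<Sum>k. w k n) \<in> ell2" and "ell2_norm (\<lambda>n. \<Sum>k. w k n) \<le> suminf b"
proof -
  have b0: "0 \<le> b k" for k using B[of k] ell2_norm_nonneg[OF w[of k]] by linarith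
  show sm: "summable (\<lambda>k. w k n)" for n
    by (rule summable_comparison_test'[OF b, of 0])
       (use cmod_le_ell2_norm[OF w] B in \<open>auto intro: order_trans\<close>)
  have "L2_set (\<lambda>n. cmod (\<Sum>k. w k n)) {..<N} \<le> suminf b" for N
  proof (rule LIMSEQ_le_const2)
    show "(\<lambda>p. L2_set (\<lambda>n. cmod (\<Sum>k<p. w k n)) {..<N}) \<longlonglongrightarrow> L2_set (\<lambda>n. cmod (\<Sum>k. w k n)) {..<N}"
      unfolding L2_set_def by (intro tendsto_intros summable_LIMSEQ sm)
    have "L2_set (\<lambda>n. cmod (\<Sum>k<p. w k n)) {..<N} \<le> (\<Sum>k<p. b k)" for p
    proof (induction p)
      case 0 show ?case by (simp add: L2_set_def)
    next
      case (Suc p)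
      have "L2_set (\<lambda>n. cmod (\<Sum>k<Suc p. w k n)) {..<N}
        \<le> L2_set (\<lambda>n. cmod (\<Sum>k<p. w k n) + cmod (w p n)) {..<N}"
        by (intro L2_set_mono) (auto intro: norm_triangle_ineq)
      also have "\<dots> \<le> L2_set (\<lambda>n. cmod (\<Sum>k<p. w k n)) {..<N} + L2_set (\<lambda>n. cmod (w p n)) {..<N}"
        by (rule L2_set_triangle_ineq)
      also have "\<dots> \<le> (\<Sum>k<p. b k) + b p"
        using Suc L2_set_le_ell2_norm[OF w, of p N] B[of p] by linarith
      finally show ?case by simp
    qed
    then show "\<exists>N'. \<forall>p\<ge>N'. L2_set (\<lambda>n. cmod (\<Sum>k<p. w k n)) {..<N} \<le> suminf b"
      using sum_le_suminf[OF b, of "{..<p}" for p] b0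
      by (intro exI[of _ 0] allI impI) (force intro: order_trans)
  qed
  then show "(\<lambda>n. \<Sum>k. w k n) \<in> ell2" and "ell2_norm (\<lambda>n. \<Sum>k. w k n) \<le> suminf b"
    by (blast intro: ell2_norm_le)+
qed

lemma schroedinger_add:
  "schroedinger f lam x (\<lambda>n. u n + v n) = (\<lambda>n. schroedinger f lam x u n + schroedinger f lam x v n)"
  by (auto simp: schroedinger_def algebra_simps)

lemma schroedinger_cmult:
  "schroedinger f lam x (\<lambda>n. a * u n) = (\<lambda>n. a * schroedinger f lam x u n)"
  by (auto simp: schroedinger_def algebra_simps)

lemma schroedinger_funpow_add:
  "(schroedinger f lam x ^^ k) (\<lambda>n. u n + v n)
     = (\<lambda>n. (schroedinger f lam x ^^ k) u n + (schroedinger f lam x ^^ k) v n)"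
  by (induction k) (simp_all add: schroedinger_add)

lemma schroedinger_funpow_cmult:
  "(schroedinger f lam x ^^ k) (\<lambda>n. a * u n) = (\<lambda>n. a * (schroedinger f lam x ^^ k) u n)"
  by (induction k) (simp_all add: schroedinger_cmult)

text \<open>
Every entry of the image depends on three entries only, so the operator commutes with entrywise convergent series.
\<close>

lemma schroedinger_suminf:
  assumes "\<And>n. summable (\<lambda>k. w k n)"
  shows "schroedinger f lam x (\<lambda>n. \<Sum>k. w k n) = (\<lambda>n. \<Sum>k. schroedinger f lam x (w k) n)"
proof
  fix n
  let ?c = "complex_of_real (lam * f ((doubling ^^ n) x))"
  have "(\<lambda>k. if n = 0 then 0 else w k (n - 1)) sums (if n = 0 then 0 else (\<Sum>k. w k (n - 1)))"
    using assms by (auto intro: summable_sums)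
  then have "(\<lambda>k. w k (n + 1) + (if n = 0 then 0 else w k (n - 1)) + ?c * w k n) sums
    ((\<Sum>k. w k (n + 1)) + (if n = 0 then 0 else (\<Sum>k. w k (n - 1))) + ?c * (\<Sum>k. w k n))"
    by (intro sums_add sums_mult summable_sums assms)
  then show "schroedinger f lam x (\<lambda>n. \<Sum>k. w k n) n = (\<Sum>k. schroedinger f lam x (w k) n)"
    unfolding schroedinger_def by (rule sums_unique)
qed

text \<open>
Above the operator norm the resolvent is given by the Neumann series.
\<close>

lemma schroedinger_spectrum_bounded:
  assumes b: "\<And>n. \<bar>f ((doubling ^^ n) x)\<bar> \<le> M" and lam: "lam \<ge> 0"
    and z: "z \<in> ell2_spectrum (schroedinger f lam x)"
  shows "cmod z \<le> 2 + lam * M"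
proof (rule ccontr)
  define B where "B = 2 + lam * M"
  assume "\<not> cmod z \<le> 2 + lam * M"
  then have Bz: "B < cmod z" by (simp add: B_def)
  have "M \<ge> 0" using b[of 0] by simp
  then have B0: "B \<ge> 0" using lam by (simp add: B_def)
  have z0: "z \<noteq> 0" using Bz B0 by auto
  let ?H = "schroedinger f lam x"
  define w where "w = (\<lambda>u k n. - ((?H ^^ k) u n) / z ^ Suc k)"
  define R where "R = (\<lambda>u n. \<Sum>k. w u k n)"
  have pow: "(?H ^^ k) u \<in> ell2 \<and> ell2_norm ((?H ^^ k) u) \<le> B ^ k * ell2_norm u" if "u \<in> ell2" for u k
  proof (induction k)
    case (Suc k)
    have "ell2_norm (?H ((?H ^^ k) u)) \<le> B * ell2_norm ((?H ^^ k) u)"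
      unfolding B_def by (rule schroedinger_bound(2)[of f x M lam, OF b lam conjunct1[OF Suc]])
    also have "\<dots> \<le> B * (B ^ k * ell2_norm u)" using Suc B0 by (intro mult_left_mono) auto
    finally show ?case using schroedinger_bound(1)[of f x M lam, OF b lam conjunct1[OF Suc]] by (simp add: mult_ac)
  qed (use that in simp)
  have w: "w u k \<in> ell2" "ell2_norm (w u k) \<le> ell2_norm u / cmod z * (B / cmod z) ^ k"
    if "u \<in> ell2" for u k
  proof -
    have "L2_set (\<lambda>n. cmod (w u k n)) {..<N} \<le> ell2_norm u / cmod z * (B / cmod z) ^ k" for N
    proof -
      have "cmod (w u k n) = cmod ((?H ^^ k) u n) * (1 / cmod z ^ Suc k)" for n
        by (simp add: w_def norm_divide norm_mult norm_power)
      then have "L2_set (\<lambda>n. cmod (w u k n)) {..<N} = L2_set (\<lambda>n. cmod ((?H ^^ k) u n)) {..<N} / cmod z ^ Suc k"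
        using L2_set_left_distrib[of "1 / cmod z ^ Suc k" "\<lambda>n. cmod ((?H ^^ k) u n)" "{..<N}"] by simp
      also have "\<dots> \<le> (B ^ k * ell2_norm u) / cmod z ^ Suc k"
        using L2_set_le_ell2_norm[of "(?H ^^ k) u" N] pow[OF that, of k]
        by (intro divide_right_mono) auto
      finally show ?thesis using z0 by (simp add: field_simps power_divide)
    qed
    then show "w u k \<in> ell2" "ell2_norm (w u k) \<le> ell2_norm u / cmod z * (B / cmod z) ^ k"
      by (blast intro: ell2_norm_le)+
  qed
  have q: "summable (\<lambda>k. c * (B / cmod z) ^ k)" "(\<Sum>k. c * (B / cmod z) ^ k) = c * (1 / (1 - B / cmod z))" for c
  proof -
    have n: "norm (B / cmod z) < 1" using Bz B0 z0 by (simp add: divide_less_eq)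
    show "summable (\<lambda>k. c * (B / cmod z) ^ k)" by (intro summable_mult summable_geometric n)
    show "(\<Sum>k. c * (B / cmod z) ^ k) = c * (1 / (1 - B / cmod z))"
      by (simp only: suminf_mult[OF summable_geometric[OF n]] suminf_geometric[OF n])
  qed
  have sm: "summable (\<lambda>k. w u k n)" if "u \<in> ell2" for u n
    by (rule ell2_series(1)[OF w(1)[OF that] w(2)[OF that] q(1)])
  have Rmem: "R u \<in> ell2" if "u \<in> ell2" for u
    unfolding R_def by (rule ell2_series(2)[OF w(1)[OF that] w(2)[OF that] q(1)])
  have Rnorm: "ell2_norm (R u) \<le> (1 / cmod z * (1 / (1 - B / cmod z))) * ell2_norm u" if "u \<in> ell2" for u
    using ell2_series(3)[OF w(1)[OF that] w(2)[OF that] q(1)] unfolding R_def[symmetric] q(2)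
    by (simp add: R_def)
  have HR: "?H (R u) n = z * R u n + u n" and RH: "R (?H u) n = z * R u n + u n" if u: "u \<in> ell2" for u n
  proof -
    \<comment> \<open>Shifting the index of summation evaluates \<open>R (?H u)\<close>; the same value of \<open>?H (R u)\<close> follows termwise.\<close>
    have sh: "(?H ^^ k) (?H u) = (?H ^^ Suc k) u" for k by (simp add: funpow_swap1)
    have e: "w (?H u) k n = z * w u (Suc k) n" for k n
      unfolding w_def sh using z0 by simp
    have "R (?H u) n = (\<Sum>k. z * w u (Suc k) n)" by (simp add: R_def e)
    also have "\<dots> = z * (\<Sum>k. w u (Suc k) n)"
      using sm[OF u, of n] by (intro suminf_mult) (subst summable_Suc_iff[of "\<lambda>k. w u k n"])
    also have "(\<Sum>k. w u (Suc k) n) = R u n - w u 0 n"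
      unfolding R_def by (rule suminf_split_head[OF sm[OF u]])
    finally show 1: "R (?H u) n = z * R u n + u n" using z0 by (simp add: w_def algebra_simps)
    have "?H (w u k) = w (?H u) k" for k
      unfolding w_def sh using schroedinger_cmult[of f lam x "- 1 / z ^ Suc k" "(?H ^^ k) u"] by simp
    then have "?H (R u) = R (?H u)"
      unfolding R_def using schroedinger_suminf[of "w u" f lam x] sm[OF u] by simp
    then show "?H (R u) n = z * R u n + u n" using 1 by simp
  qed
  have Radd: "R (\<lambda>n. u n + v n) = (\<lambda>n. R u n + R v n)" if "u \<in> ell2" "v \<in> ell2" for u v
  proof
    fix n
    have "w (\<lambda>n. u n + v n) k n = w u k n + w v k n" for k
      by (simp add: w_def schroedinger_funpow_add add_divide_distrib diff_divide_distrib)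
    then show "R (\<lambda>n. u n + v n) n = R u n + R v n"
      unfolding R_def by (simp add: suminf_add[OF sm[OF that(1)] sm[OF that(2)]])
  qed
  have Rmult: "R (\<lambda>n. a * u n) = (\<lambda>n. a * R u n)" if "u \<in> ell2" for u a
  proof
    fix n
    have "w (\<lambda>n. a * u n) k n = a * w u k n" for k
      by (simp add: w_def schroedinger_funpow_cmult)
    then show "R (\<lambda>n. a * u n) n = a * R u n"
      unfolding R_def by (simp add: suminf_mult[OF sm[OF that]])
  qed
  have bl: "ell2_bounded_linear R"
    unfolding ell2_bounded_linear_def using Rmem Radd Rmult Rnorm by blast
  have res: "R (\<lambda>n. ?H u n - z * u n) = u" if u: "u \<in> ell2" for u
  proof
    fix n
    have Hu: "?H u \<in> ell2" by (rule schroedinger_bound(1)[of f x M lam, OF b lam u])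
    have zu: "(\<lambda>n. - z * u n) \<in> ell2"
    proof (rule ell2_norm_le)
      fix N
      have "L2_set (\<lambda>n. cmod (- z * u n)) {..<N} = cmod z * L2_set (\<lambda>n. cmod (u n)) {..<N}"
        by (simp add: norm_mult L2_set_right_distrib)
      also have "\<dots> \<le> cmod z * ell2_norm u" by (intro mult_left_mono L2_set_le_ell2_norm u) auto
      finally show "L2_set (\<lambda>n. cmod (- z * u n)) {..<N} \<le> cmod z * ell2_norm u" .
    qed
    show "R (\<lambda>n. ?H u n - z * u n) n = u n"
      using Radd[OF Hu zu] Rmult[OF u, of "- z"] RH[OF u, of n] by (simp add: fun_eq_iff)
  qed
  have "z \<in> ell2_resolvent_set ?H"
    unfolding ell2_resolvent_set_def using bl res HR by (auto simp: fun_eq_iff intro!: exI[of _ R])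
  then show False using z by (simp add: ell2_spectrum_def)
qed

section \<open>Hoelder continuity on the spectrum\<close>

lemma cocycle_restrict_unit:
  "cocycle (\<lambda>x. if x \<in> {0..<1} then f x else 0) lam E n x = cocycle f lam E n x"
proof (induction n)
  case (Suc n)
  have "(doubling ^^ Suc n) x \<in> {0..<1}" by (simp add: doubling_in_unit del: atLeastLessThan_iff)
  then show ?case using Suc by (simp add: transfer_matrix_def del: funpow.simps)
qed simp

lemma lyapunov_restrict_unit:
  "lyapunov (\<lambda>x. if x \<in> {0..<1} then f x else 0) lam E = lyapunov f lam E"
  unfolding lyapunov_def cocycle_restrict_unit ..

text \<open>
The mean value theorem on the open interval; right continuity extends the bound to the endpoint 0.
\<close>

lemma steep_of_deriv:
  fixes f :: "real \<Rightarrow> real"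
  assumes diff: "f C1_differentiable_on {0<..<1}" and f0: "(f \<longlongrightarrow> f 0) (at_right 0)"
    and mu: "\<And>x. x \<in> {0<..<1} \<Longrightarrow> mu \<le> \<bar>deriv f x\<bar>"
    and xy: "x \<in> {0..<1}" "y \<in> {0..<1}"
  shows "mu * \<bar>x - y\<bar> \<le> \<bar>f x - f y\<bar>"
proof -
  have der: "DERIV f x :> deriv f x" if "x \<in> {0<..<1}" for x
    using diff that by (auto simp: C1_differentiable_on_eq DERIV_deriv_iff_real_differentiable)
  have inner: "mu * (y - x) \<le> \<bar>f y - f x\<bar>" if "0 < x" "x < y" "y < 1" for x y
  proof -
    have "\<exists>z>x. z < y \<and> f y - f x = (y - x) * deriv f z"
    proof (rule MVT2[OF \<open>x < y\<close>])
      fix w assume "x \<le> w" "w \<le> y"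
      then show "DERIV f w :> deriv f w" using that by (intro der) auto
    qed
    then obtain z where z: "x < z" "z < y" "f y - f x = (y - x) * deriv f z" by blast
    have "mu * (y - x) \<le> \<bar>deriv f z\<bar> * (y - x)" using mu[of z] z that by (intro mult_right_mono) auto
    then show ?thesis using z that by (simp add: abs_mult mult.commute)
  qed
  have left: "mu * (y - 0) \<le> \<bar>f y - f 0\<bar>" if y: "0 < y" "y < 1" for y
  proof (rule tendsto_le[of "at_right (0::real)"])
    show "((\<lambda>x. \<bar>f y - f x\<bar>) \<longlongrightarrow> \<bar>f y - f 0\<bar>) (at_right 0)" by (intro tendsto_intros f0)
    show "((\<lambda>x. mu * (y - x)) \<longlongrightarrow> mu * (y - 0)) (at_right 0)" by (intro tendsto_intros)
    show "\<forall>\<^sub>F x in at_right 0. mu * (y - x) \<le> \<bar>f y - f x\<bar>"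
      using y unfolding eventually_at_right_field
      by (intro exI[of _ y]) (use inner y in auto)
  qed simp
  have "mu * (y - x) \<le> \<bar>f y - f x\<bar>" if "x \<in> {0..<1}" "y \<in> {0..<1}" "x < y" for x y
    using inner[of x y] left[of y] that by (cases "x = 0") auto
  from this[of x y] this[of y x] xy show ?thesis
    by (cases x y rule: linorder_cases) (auto simp: abs_minus_commute)
qed


context steep_potential begin

lemma strong_coupling_if_large:
  obtains lam0 where "lam0 > 0"
    "\<And>lam. lam0 < lam \<Longrightarrow> strong_coupling f M mu lam (lam * (mu / 128)) (lam * (4 + 2 * M))"
proof -
  have M0: "M \<ge> 0" using f_bounded[of 0] by simp
  define a where "a = ln (mu / 128)"
  define b where "b = ln (4 + 2 * M)"
  have b0: "b \<ge> 0" using M0 by (simp add: b_def)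
  define lam0 where "lam0 = exp (16 * (1 + \<bar>a\<bar> + b))"
  show ?thesis
  proof (rule that)
    show "lam0 > 0" by (simp add: lam0_def)
    fix lam assume lam: "lam0 < lam"
    let ?L = "ln lam" and ?kap = "lam * (mu / 128)" and ?K = "lam * (4 + 2 * M)"
    have lam_pos: "lam > 0" using lam by (simp add: lam0_def order_less_trans[OF exp_gt_zero])
    have L: "16 * (1 + \<bar>a\<bar> + b) < ?L"
      using ln_less_cancel_iff[of lam0 lam] lam lam_pos by (simp add: lam0_def)
    have "0 \<le> 16 * (1 + \<bar>a\<bar> + b)" using b0 by simp
    then have "?L \<ge> 0" using L by (rule less_imp_le[OF le_less_trans])
    then have lam1: "lam \<ge> 1" using ln_ge_zero_iff[OF lam_pos] by blast
    have lnk: "ln ?kap = ?L + a"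
      unfolding a_def by (rule ln_mult_pos) (use lam_pos mu_pos in auto)
    have lnK: "ln ?K = ?L + b"
      unfolding b_def by (rule ln_mult_pos) (use lam_pos M0 in auto)
    have kap1: "?kap \<ge> 1"
    proof -
      have "?kap > 0" using lam_pos mu_pos by simp
      moreover have "ln ?kap \<ge> 0" using L b0 unfolding lnk by (simp add: abs_if split: if_splits)
      ultimately show ?thesis using ln_ge_zero_iff by blast
    qed
    show "strong_coupling f M mu lam ?kap ?K"
    proof
      show "lam \<ge> 1" by (rule lam1)
      show "128 * ?kap \<le> lam * mu" by simp
      show "?kap \<ge> 1" by (rule kap1)
      show "4 + 2 * lam * M \<le> ?K" using lam1 by (simp add: distrib_left)
      show "?L / 2 \<le> ln ?kap - 1 - 3 / 32 * (2 * ln ?kap + ln ?K)"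
        unfolding lnk lnK using L b0 by (simp add: field_simps)
      show "11 * ln ?K \<le> 12 * ?L" unfolding lnK using L b0 by simp
      show "?L \<ge> 1" using L b0 by simp
    qed
  qed
qed

end

text \<open>
On a bounded set of energies the Lipschitz term is absorbed into the Hoelder term.
\<close>

lemma (in strong_coupling) lyapunov_hoelder_energies:
  obtains C where "C > 0"
    "\<And>E E'. E \<in> energies \<Longrightarrow> E' \<in> energies \<Longrightarrow> E \<noteq> E' \<Longrightarrow>
       \<bar>lyapunov f lam E - lyapunov f lam E'\<bar> < C * \<bar>E - E'\<bar> powr (1/30000 / ln lam ^ 3)"
proof -
  let ?L = "ln lam"
  define t where "t = 2 * (1/30000 / ?L ^ 3)"
  have t_half: "t / 2 = 1/30000 / ?L ^ 3" by (simp add: t_def)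
  have L3: "?L \<le> ?L ^ 3" using power_increasing[of 1 3 ?L] ln_lam_ge_1 by simp
  have t: "t > 0" using ln_lam_ge_1 by (simp add: t_def)
  have t2: "10952 * t * ?L \<le> 1" using L3 ln_lam_ge_1 by (simp add: t_def field_simps)
  have t_le: "t / 2 \<le> 1"
  proof -
    have "10952 * t * 1 \<le> 10952 * t * ?L" using t ln_lam_ge_1 by (intro mult_left_mono) auto
    then have "10952 * t \<le> 1" using t2 by linarith
    then show ?thesis by simp
  qed
  obtain C where C: "C > 0" "\<And>E E'. E \<in> energies \<Longrightarrow> E' \<in> energies \<Longrightarrow>
     \<bar>lyapunov f lam E - lyapunov f lam E'\<bar> \<le> \<bar>E - E'\<bar> + C * \<bar>E - E'\<bar> powr (t / 2)"
    using lyapunov_hoelder[OF t t2] by blast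
  define D where "D = 2 * (2 + lam * M)"
  have "M \<ge> 0" using f_bounded[of 0] by simp
  then have D1: "D \<ge> 1" using lam_ge_1 by (simp add: D_def)
  show ?thesis
  proof (rule that)
    show "D + C + 1 > 0" using D1 C(1) by simp
    fix E E' assume E: "E \<in> energies" "E' \<in> energies" and ne: "E \<noteq> E'"
    let ?d = "\<bar>E - E'\<bar>"
    have d: "0 < ?d" "?d \<le> D" using ne E by (auto simp: energies_def D_def)
    have "?d = ?d powr (1 - t / 2) * ?d powr (t / 2)" using d by (simp flip: powr_add)
    also have "\<dots> \<le> D powr 1 * ?d powr (t / 2)"
    proof (rule mult_right_mono)
      have "?d powr (1 - t / 2) \<le> D powr (1 - t / 2)" using d t_le by (intro powr_mono2) auto
      also have "\<dots> \<le> D powr 1" using t D1 by (intro powr_mono) auto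
      finally show "?d powr (1 - t / 2) \<le> D powr 1" .
    qed simp
    finally have dd: "?d \<le> D * ?d powr (t / 2)" using D1 by simp
    have "?d powr (t / 2) > 0" using d by simp
    moreover have "(D + C + 1) * ?d powr (t / 2) = D * ?d powr (t / 2) + C * ?d powr (t / 2) + ?d powr (t / 2)"
      by (simp add: algebra_simps)
    ultimately have "?d + C * ?d powr (t / 2) < (D + C + 1) * ?d powr (t / 2)"
      using dd by linarith
    then show "\<bar>lyapunov f lam E - lyapunov f lam E'\<bar> < (D + C + 1) * ?d powr (1/30000 / ?L ^ 3)"
      using C(2)[OF E] unfolding t_half by linarith
  qed
qed

theorem theorem2p3:
  fixes f :: "real \<Rightarrow> real"
  assumes "mono_on {0..<1} f \<or> antimono_on {0..<1} f"
    and "f C1_differentiable_on {0<..<1}"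
    and "(f \<longlongrightarrow> f 0) (at_right 0)"
    and "\<exists>l. (f \<longlongrightarrow> l) (at_left 1) \<and> l \<noteq> f 0"
    and "\<exists>d. (f has_real_derivative d) (at_right 0)"
    and "(INF x\<in>{0<..<1}. \<bar>deriv f x\<bar>) > 0"
    and "bounded (f ` {0<..<1})" and "bounded (deriv f ` {0<..<1})"
  shows "\<exists>c>0. \<exists>lam0>0. \<forall>lam>lam0. \<exists>C>0.
    \<forall>x\<in>{0..<1}. \<forall>E1 E2 :: real. E1 \<noteq> E2 \<longrightarrow>
      complex_of_real E1 \<in> ell2_spectrum (schroedinger f lam x) \<longrightarrow>
      complex_of_real E2 \<in> ell2_spectrum (schroedinger f lam x) \<longrightarrow>
      \<bar>lyapunov f lam E1 - lyapunov f lam E2\<bar> < C * \<bar>E1 - E2\<bar> powr (c / (ln lam) ^ 3)"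
proof -
  \<comment> \<open>The cocycle sees \<open>f\<close> only on the fundamental domain; cutting \<open>f\<close> off outside makes it a Borel function.\<close>
  define f0 where "f0 = (\<lambda>x. if x \<in> {0..<1} then f x else 0)"
  define mu where "mu = (INF x\<in>{0<..<1}. \<bar>deriv f x\<bar>)"
  obtain M1 where "\<forall>y\<in>f ` {0<..<1}. norm y \<le> M1"
    using assms(7) unfolding bounded_iff by blast
  then have M1: "\<bar>f x\<bar> \<le> M1" if "x \<in> {0<..<1}" for x using that by auto
  define M where "M = max M1 \<bar>f 0\<bar>"
  have fM: "\<bar>f x\<bar> \<le> M" if "x \<in> {0..<1}" for x
    using M1[of x] that by (cases "x = 0") (auto simp: M_def)
  have mu0: "mu > 0" using assms(6) by (simp add: mu_def)
  have mu: "mu \<le> \<bar>deriv f x\<bar>" if "x \<in> {0<..<1}" for x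
    unfolding mu_def by (rule cINF_lower[OF _ that]) (auto intro!: bdd_belowI[of _ 0])
  interpret steep_potential f0 M mu
  proof
    have "f differentiable_on {0<..<1}" using assms(2) by (rule C1_diff_imp_diff)
    then have [measurable]: "(\<lambda>x. indicator {0<..<1} x *\<^sub>R f x) \<in> borel_measurable borel"
      by (intro borel_measurable_continuous_on_indicator differentiable_imp_continuous_on) auto
    have "f0 = (\<lambda>x. indicator {0<..<1} x *\<^sub>R f x + indicator {0} x *\<^sub>R f 0)"
      by (auto simp: f0_def fun_eq_iff indicator_def)
    also have "\<dots> \<in> borel_measurable borel" by measurable
    finally show "f0 \<in> borel_measurable borel" .
    show "\<bar>f0 x\<bar> \<le> M" if "x \<in> {0..<1}" for x using fM[OF that] that by (simp add: f0_def)
    show "mu * \<bar>x - y\<bar> \<le> \<bar>f0 x - f0 y\<bar>" if "x \<in> {0..<1}" "y \<in> {0..<1}" for x y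
      using steep_of_deriv[OF assms(2,3) mu that] that by (simp add: f0_def)
  qed (rule mu0)
  obtain lam0 where lam0: "lam0 > 0" and
    strong: "\<And>lam. lam0 < lam \<Longrightarrow> strong_coupling f0 M mu lam (lam * (mu / 128)) (lam * (4 + 2 * M))"
    using strong_coupling_if_large by blast
  have hoelder: "\<exists>C>0. \<forall>x\<in>{0..<1}. \<forall>E1 E2 :: real. E1 \<noteq> E2 \<longrightarrow>
      complex_of_real E1 \<in> ell2_spectrum (schroedinger f lam x) \<longrightarrow>
      complex_of_real E2 \<in> ell2_spectrum (schroedinger f lam x) \<longrightarrow>
      \<bar>lyapunov f lam E1 - lyapunov f lam E2\<bar> < C * \<bar>E1 - E2\<bar> powr (1/30000 / (ln lam) ^ 3)"
    if "lam0 < lam" for lam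
  proof -
    interpret strong_coupling f0 M mu lam "lam * (mu / 128)" "lam * (4 + 2 * M)"
      by (rule strong[OF that])
    obtain C where C: "C > 0" "\<And>E E'. E \<in> energies \<Longrightarrow> E' \<in> energies \<Longrightarrow> E \<noteq> E' \<Longrightarrow>
       \<bar>lyapunov f0 lam E - lyapunov f0 lam E'\<bar> < C * \<bar>E - E'\<bar> powr (1/30000 / ln lam ^ 3)"
      using lyapunov_hoelder_energies by blast
    have spec: "E \<in> energies"
      if "x \<in> {0..<1}" "complex_of_real E \<in> ell2_spectrum (schroedinger f lam x)" for x E
    proof -
      have "\<bar>f ((doubling ^^ n) x)\<bar> \<le> M" for n by (intro fM funpow_doubling_in_unit that)
      from schroedinger_spectrum_bounded[of f x M lam, OF this _ that(2)] lam_ge_1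
      show ?thesis by (simp add: energies_def)
    qed
    show ?thesis
    proof (intro exI[of _ C] conjI ballI allI impI C(1))
      fix x E1 E2 :: real
      assume x: "x \<in> {0..<1}" and ne: "E1 \<noteq> E2"
        and s: "complex_of_real E1 \<in> ell2_spectrum (schroedinger f lam x)"
          "complex_of_real E2 \<in> ell2_spectrum (schroedinger f lam x)"
      show "\<bar>lyapunov f lam E1 - lyapunov f lam E2\<bar> < C * \<bar>E1 - E2\<bar> powr (1/30000 / ln lam ^ 3)"
        using C(2)[OF spec[OF x s(1)] spec[OF x s(2)] ne]
        unfolding f0_def lyapunov_restrict_unit .
    qed
  qed
  show ?thesis
    by (rule exI[of _ "1/30000"], rule conjI, simp, rule exI[of _ lam0])
       (use lam0 hoelder in blast)
qed

end
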